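(* Let $m$ agents indexed by $i=1,\ldots,m$ each observe, at each time step $j=1,2,\ldots$, a pair $(x_{i,j},y_{i,j})$ generated by $y_{i,j}=\Theta x_{i,j}+\eta_{i,j}$, where $\Theta\in\mathbb{R}^{l\times n}$ is unknown, and $x_{i,j}\sim\mathcal{N}(\mu_{i,j},\sigma_x^2I_n)$, $\eta_{i,j}\sim\mathcal{N}(0,\sigma_\eta^2I_l)$ are Gaussian random vectors, all mutually independent over time and agents, with deterministic means satisfying $\sup_{i,j}\|\mu_{i,j}\|=\hat{\mu}<\infty$ (here $\sigma_x>0$, $\sigma_\eta>0$). Let the global least-squares estimate be $\hat{\Theta}_{t+1}=\big(\sum_{i=1}^m\sum_{j=1}^t y_{i,j}x_{i,j}^*\big)\big(\sum_{i=1}^m\sum_{j=1}^tx_{i,j}x_{i,j}^*\big)^{-1}$. Fix $\delta>0$ and let $t\ge\frac{1}{m}\max(t_1,t_2,t_3)$, where $t_1=8n+16\log\frac{2}{\delta}$, $t_2=\left(\frac{16\hat{\mu}(\sqrt{4n}+\sqrt{2\log\frac{2}{\delta}})}{\sigma_x}\right)^2$, $t_3=2(n+l)\log\frac{1}{\delta}$. Let $\bar{\mu}_t=\frac{4}{mt\sigma_x^2}\sum_{i=1}^m\sum_{j=1}^t\mu_{i,j}\mu_{i,j}^*$. Then with probability at least $1-4\delta$, $$\|\hat{\Theta}_{t+1}-\Theta\|\le\frac{C_1}{\sqrt{mt}\,\sigma_x^2\,\lambda_{\min}(I_n+\bar{\mu}_t)},$$ where $C_1=8\sigma_\eta\left(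4\sigma_x\sqrt{(n+l)\log\frac{9}{\delta}}+\hat{\mu}\big(\sqrt{2(l+n)}+2\sqrt{\log\frac{2}{\delta}}\big)\right)$.
   Context: $\|\cdot\|$ denotes the spectral norm, $A^*$ the (conjugate) transpose, and $\lambda_{\min}$ the smallest eigenvalue (in magnitude). *)

theory Defs
  imports "HOL-Probability.Probability"
begin

definition spec_norm :: "real^'n^'m \<Rightarrow> real" where
  "spec_norm A = onorm (\<lambda>v. A *v v)"

text \<open>Smallest eigenvalue in magnitude (real eigenvalues; the matrices used are symmetric).\<close>
definition lambda_min :: "real^'n^'n \<Rightarrow> real" where
  "lambda_min A = Min {\<bar>c\<bar> | c. \<exists>v. v \<noteq> 0 \<and> A *v v = c *\<^sub>R v}"

definition outer :: "real^'m \<Rightarrow> real^'n \<Rightarrow> real^'n^'m" where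
  "outer u v = (\<chi> a b. u $ a * v $ b)"

definition iso_gauss_density :: "real^'n \<Rightarrow> real \<Rightarrow> real^'n \<Rightarrow> real" where
  "iso_gauss_density mu \<sigma> v =
     (2 * pi * \<sigma>\<^sup>2) powr (- real CARD('n) / 2) * exp (- (norm (v - mu))\<^sup>2 / (2 * \<sigma>\<^sup>2))"

end

theory Submission
  imports Defs
begin

text \<open>Write \<open>N = m t\<close>, \<open>X\<close> for the matrix with columns \<open>x i j\<close> and \<open>H\<close> for the noise matrix. The error is
  \<open>H X\<^sup>T (X X\<^sup>T)\<^sup>-\<^sup>1\<close>, so it suffices to bound \<open>v \<bullet> X X\<^sup>T v\<close> from below and \<open>\<bar>H X\<^sup>T v\<bar>\<close> by a multiple of
  \<open>\<bar>X\<^sup>T v\<bar>\<close>, uniformly in \<open>v\<close>. For a single \<open>v\<close> both are Chernoff bounds for explicit Gaussian integrals; the noise is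
  treated conditionally on \<open>X\<close>. Uniformity comes from integrating the exponential moments over a shell of a norm adapted
  to the problem, instead of a covering net: for the design matrix, \<open>p v\<^sup>2 = \<bar>v\<bar>\<^sup>2 + 2 / (N \<sigma>\<^sup>2) \<Sum> (\<mu> \<bullet> v)\<^sup>2\<close>, which
  absorbs large means; for the noise, \<open>p v = \<bar>X\<^sup>T v\<bar>\<close>. This gives
  \<open>X X\<^sup>T \<ge> N \<sigma>\<^sup>2 (1 + \<lambda>) / 16\<close> and \<open>\<bar>H X\<^sup>T v\<bar>\<^sup>2 \<le> \<sigma>\<eta>\<^sup>2 (10 n + 2 l + 4 ln (2 / \<delta>)) \<bar>X\<^sup>T v\<bar>\<^sup>2\<close>, and the estimate
  \<open>\<lambda> \<le> 1 + 4 (\<mu>hat / \<sigma>)\<^sup>2 / n\<close> turns the quotient into the stated bound.\<close>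

section \<open>Smallest eigenvalue and least squares\<close>

text \<open>Measuring the noise against |X^T v| rather than |v| does two things: no condition number
  of the design enters the quotient, and the exponential moment of H X^T v depends on v only through
  |X^T v|, so its constants are the same for every design. The norm \<open>p\<close> of the design
  part is natural because the mean of v \<bullet> X X^T v is N \<sigma>^2 (p v^2 + |v|^2) / 2, hence
  comparable to N \<sigma>^2 p v^2 whatever the means are. A shell average controls the product of
  the values at v + z and v - z, and for the exponential of a quadratic form the parallelogram law
  evaluates this product. The leftover term in z has the right sign for an upper tail and the wrong
  one for a lower tail, which is why a crude upper bound on X X^T precedes the lower bound.
  Uniformity costs a factor ((1 + e) / e)^n, a ratio of volumes that is the same for all norms; the
  width e is 1/4 and 1/16 for the two design tails and 1/10 for the noise. Each of the three
  exceptional events has probability at most \<delta> / 2.\<close>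

definition eigenvalues :: "real^'n^'n \<Rightarrow> real set" where
  "eigenvalues A = {c. \<exists>v. v \<noteq> 0 \<and> A *v v = c *\<^sub>R v}"

lemma lambda_min_eq: "lambda_min A = Min (abs ` eigenvalues A)"
  unfolding lambda_min_def eigenvalues_def by (rule arg_cong[of _ _ Min]) auto

text \<open>\<open>Min\<close> is informative only on finite sets. One eigenvector per eigenvalue
  gives a pairwise orthogonal family without zero, hence an independent one, and independent sets
  are finite.\<close>

lemma finite_eigenvalues:
  fixes A :: "real^'n^'n"
  assumes sym: "\<And>u v. u \<bullet> (A *v v) = (A *v u) \<bullet> v"
  shows "finite (eigenvalues A)"
proof -
  have "\<forall>c\<in>eigenvalues A. \<exists>v. v \<noteq> 0 \<and> A *v v = c *\<^sub>R v" by (auto simp: eigenvalues_def)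
  then obtain f where f: "\<And>c. c \<in> eigenvalues A \<Longrightarrow> f c \<noteq> 0 \<and> A *v f c = c *\<^sub>R f c"
    by (metis (no_types))
  have orth: "f c \<bullet> f d = 0" if "c \<in> eigenvalues A" "d \<in> eigenvalues A" "c \<noteq> d" for c d
    using sym[of "f c" "f d"] f[OF that(1)] f[OF that(2)] that(3) by simp
  have inj: "inj_on f (eigenvalues A)"
  proof (rule inj_onI, rule ccontr)
    fix c d assume "c \<in> eigenvalues A" "d \<in> eigenvalues A" "f c = f d" "c \<noteq> d"
    thus False using orth[of c d] f[of d] by simp
  qed
  have "pairwise orthogonal (f ` eigenvalues A)"
    by (auto simp: pairwise_def orthogonal_def intro!: orth)
  moreover have "0 \<notin> f ` eigenvalues A" using f by force
  ultimately have "independent (f ` eigenvalues A)" by (rule pairwise_orthogonal_independent)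
  hence "finite (f ` eigenvalues A)" by (rule independent_imp_finite)
  thus ?thesis using inj by (rule finite_imageD)
qed

text \<open>A minimiser \<open>v\<close> of the quadratic form on the compact unit sphere is an
  eigenvector: otherwise moving from \<open>v\<close> against the residual
  \<open>A *v v - c *\<^sub>R v\<close> would push the form below its minimum.\<close>

lemma rayleigh_minimum:
  fixes A :: "real^'n^'n"
  assumes sym: "\<And>u v. u \<bullet> (A *v v) = (A *v u) \<bullet> v"
  obtains c where "c \<in> eigenvalues A" "\<And>w. c * (norm w)\<^sup>2 \<le> w \<bullet> (A *v w)"
proof -
  have "continuous_on (sphere 0 1) (\<lambda>v. v \<bullet> (A *v v))"
    by (intro continuous_intros)
  moreover have "sphere (0::real^'n) 1 \<noteq> {}" by simp
  ultimately obtain v where v: "norm v = 1" and min: "\<And>w. norm w = 1 \<Longrightarrow> v \<bullet> (A *v v) \<le> w \<bullet> (A *v w)"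
    using continuous_attains_inf[of "sphere (0::real^'n) 1" "\<lambda>v. v \<bullet> (A *v v)"] by auto
  define c where "c = v \<bullet> (A *v v)"
  have le: "c * (norm w)\<^sup>2 \<le> w \<bullet> (A *v w)" for w
  proof (cases "w = 0")
    case False
    have "c \<le> (w /\<^sub>R norm w) \<bullet> (A *v (w /\<^sub>R norm w))"
      unfolding c_def by (rule min) (use False in simp)
    also have "\<dots> = w \<bullet> (A *v w) / (norm w)\<^sup>2"
      by (simp add: matrix_vector_mult_scaleR power2_eq_square divide_inverse mult_ac)
    finally show ?thesis using False by (simp add: field_simps)
  qed simp
  define b where "b = A *v v - c *\<^sub>R v"
  define K where "K = b \<bullet> (A *v b) - c * (b \<bullet> b)"
  have K: "0 \<le> K" using le[of b] by (simp add: K_def power2_norm_eq_inner)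
  \<comment> \<open>The minimality inequality \<open>le\<close> at \<open>v + s *\<^sub>R b\<close>:
    the constant terms cancel, and a linear term in \<open>s\<close> survives unless the residual
    \<open>b\<close> vanishes.\<close>
  have quad: "0 \<le> 2 * s * (b \<bullet> b) + s\<^sup>2 * K" for s
  proof -
    have vv: "v \<bullet> v = 1" using v by (simp add: norm_eq_1)
    have "A *v v = b + c *\<^sub>R v" by (simp add: b_def)
    hence Avb: "(A *v v) \<bullet> b = b \<bullet> b + c * (v \<bullet> b)"
      by (simp add: inner_add_left)
    have vAb: "v \<bullet> (A *v b) = b \<bullet> b + c * (v \<bullet> b)" using sym[of v b] Avb by simp
    have bAv: "b \<bullet> (A *v v) = b \<bullet> b + c * (v \<bullet> b)" using Avb by (simp add: inner_commute)
    have e1: "(v + s *\<^sub>R b) \<bullet> (v + s *\<^sub>R b) = 1 + 2 * s * (v \<bullet> b) + s\<^sup>2 * (b \<bullet> b)"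
      by (simp add: inner_add_left inner_add_right vv inner_commute[of b v] power2_eq_square algebra_simps)
    have e2: "(v + s *\<^sub>R b) \<bullet> (A *v (v + s *\<^sub>R b)) = c + s * (v \<bullet> (A *v b)) + s * (b \<bullet> (A *v v)) + s\<^sup>2 * (b \<bullet> (A *v b))"
      by (simp add: matrix_vector_mult_scaleR matrix_vector_right_distrib inner_add_left inner_add_right
        c_def[symmetric] power2_eq_square algebra_simps)
    have "c * ((v + s *\<^sub>R b) \<bullet> (v + s *\<^sub>R b)) \<le> (v + s *\<^sub>R b) \<bullet> (A *v (v + s *\<^sub>R b))"
      using le[of "v + s *\<^sub>R b"] by (simp add: power2_norm_eq_inner)
    thus ?thesis unfolding e1 e2 vAb bAv K_def by (simp add: algebra_simps)
  qed
  have "b \<bullet> b = 0"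
  proof (rule ccontr)
    assume "b \<bullet> b \<noteq> 0"
    hence pos: "0 < b \<bullet> b" by simp
    \<comment> \<open>A negative step short enough for the linear term to win; \<open>K + 1\<close>
      in place of \<open>K\<close> keeps the denominator positive when \<open>K\<close> is
      zero.\<close>
    have "0 \<le> 2 * (- (b \<bullet> b) / (K + 1)) * (b \<bullet> b) + (- (b \<bullet> b) / (K + 1))\<^sup>2 * K" by (rule quad)
    also have "\<dots> = - ((b \<bullet> b)\<^sup>2 * (K + 2) / (K + 1)\<^sup>2)"
      using K by (simp add: divide_simps) (simp add: power2_eq_square algebra_simps)
    finally have "(b \<bullet> b)\<^sup>2 * (K + 2) / (K + 1)\<^sup>2 \<le> 0" by simp
    moreover have "0 < (b \<bullet> b)\<^sup>2 * (K + 2) / (K + 1)\<^sup>2" using pos K by (intro divide_pos_pos mult_pos_pos) auto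
    ultimately show False by simp
  qed
  hence "A *v v = c *\<^sub>R v" by (simp add: b_def)
  hence "c \<in> eigenvalues A" using v by (auto simp: eigenvalues_def intro!: exI[of _ v])
  with le show thesis by (rule that[rotated])
qed

text \<open>Every eigenvalue is at least 1, so magnitude and value agree. The minimal Rayleigh value
  is itself an eigenvalue, so \<open>lambda_min A\<close> does not exceed it.\<close>

lemma lambda_min_psd:
  fixes A :: "real^'n^'n"
  assumes sym: "\<And>u v. u \<bullet> (A *v v) = (A *v u) \<bullet> v"
    and ge: "\<And>v. (norm v)\<^sup>2 \<le> v \<bullet> (A *v v)"
  shows "1 \<le> lambda_min A" and "lambda_min A * (norm w)\<^sup>2 \<le> w \<bullet> (A *v w)"
proof -
  obtain c where c: "c \<in> eigenvalues A" "\<And>w. c * (norm w)\<^sup>2 \<le> w \<bullet> (A *v w)"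
    using rayleigh_minimum[OF sym] by blast
  have fin: "finite (eigenvalues A)" by (rule finite_eigenvalues[OF sym])
  have ge1: "1 \<le> d" if d: "d \<in> eigenvalues A" for d
  proof -
    obtain v where v: "v \<noteq> 0" "A *v v = d *\<^sub>R v" using d by (auto simp: eigenvalues_def)
    thus ?thesis using ge[of v] by (simp add: power2_norm_eq_inner)
  qed
  show "1 \<le> lambda_min A"
    unfolding lambda_min_eq using c(1) fin by (subst Min_ge_iff) (auto dest: ge1 intro: order_trans[OF _ abs_ge_self])
  have "lambda_min A \<le> c"
    unfolding lambda_min_eq using c(1) fin ge1[OF c(1)] by (intro Min_le) (auto intro!: image_eqI[of _ _ c])
  thus "lambda_min A * (norm w)\<^sup>2 \<le> w \<bullet> (A *v w)"
    using c(2)[of w] by (meson mult_right_mono order_trans zero_le_power2)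
qed

section \<open>The least-squares error in terms of design and noise\<close>

lemma outer_sum_mult:
  fixes a :: "'c \<Rightarrow> real^'m" and b :: "'c \<Rightarrow> real^'n"
  shows "(\<Sum>k\<in>K. outer (a k) (b k)) *v y = (\<Sum>k\<in>K. (b k \<bullet> y) *\<^sub>R a k)"
proof -
  have 1: "outer u v *v y = (v \<bullet> y) *\<^sub>R u" for u :: "real^'m" and v y :: "real^'n"
    by (simp add: vec_eq_iff outer_def matrix_vector_mult_def inner_vec_def sum_distrib_left mult_ac)
  have 2: "(\<Sum>k\<in>K. B k) *v y = (\<Sum>k\<in>K. B k *v y)" for B :: "'c \<Rightarrow> real^'n^'m" and y :: "real^'n"
    by (induction K rule: infinite_finite_induct) (auto simp: matrix_vector_mult_add_rdistrib)
  show ?thesis by (simp add: 1 2)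
qed

lemma matrix_inv_inverse:
  fixes A :: "real^'n^'n"
  assumes "invertible A" shows "A ** matrix_inv A = mat 1"
  using assms someI_ex[of "\<lambda>B. A ** B = mat 1 \<and> B ** A = mat 1"]
  by (auto simp: invertible_def matrix_inv_def)

text \<open>For v = W y the error maps v to the noise sum at y, whose squared norm is at most T^2 S
  with S = y \<bullet> W y. Since \<open>upper\<close> is relative to the same S, the lower bound on
  W is paid for only once, with a square root.\<close>

lemma least_squares_error:
  fixes x :: "'k \<Rightarrow> real^'n" and \<eta> :: "'k \<Rightarrow> real^'l" and \<Theta> :: "real^'n^'l"
  assumes lower: "\<And>v. \<kappa> * (norm v)\<^sup>2 \<le> (\<Sum>k\<in>K. (x k \<bullet> v)\<^sup>2)" and \<kappa>: "0 < \<kappa>" and T: "0 \<le> T"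
    and upper: "\<And>v. (norm (\<Sum>k\<in>K. (x k \<bullet> v) *\<^sub>R \<eta> k))\<^sup>2 \<le> T\<^sup>2 * (\<Sum>k\<in>K. (x k \<bullet> v)\<^sup>2)"
  shows "spec_norm ((\<Sum>k\<in>K. outer (\<Theta> *v x k + \<eta> k) (x k)) ** matrix_inv (\<Sum>k\<in>K. outer (x k) (x k)) - \<Theta>)
    \<le> T / sqrt \<kappa>"
proof -
  define W where "W = (\<Sum>k\<in>K. outer (x k) (x k))"
  define Y where "Y = (\<Sum>k\<in>K. outer (\<Theta> *v x k + \<eta> k) (x k))"
  have quad: "y \<bullet> (W *v y) = (\<Sum>k\<in>K. (x k \<bullet> y)\<^sup>2)" for y
    by (simp add: W_def outer_sum_mult inner_sum_right power2_eq_square inner_commute)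
  have "y = 0" if "W *v y = 0" for y
    using lower[of y] quad[of y] that \<kappa> by (simp add: mult_le_0_iff)
  hence "invertible W"
    unfolding invertible_left_inverse matrix_left_invertible_ker by blast
  hence inv: "W ** matrix_inv W = mat 1" by (rule matrix_inv_inverse)
  show ?thesis
    unfolding spec_norm_def W_def[symmetric] Y_def[symmetric]
  proof (rule onorm_le)
    fix v
    define y where "y = matrix_inv W *v v"
    define S where "S = (\<Sum>k\<in>K. (x k \<bullet> y)\<^sup>2)"
    have S0: "0 \<le> S" by (simp add: S_def sum_nonneg)
    have v: "v = W *v y" by (simp add: y_def matrix_vector_mul_assoc inv)
    have "Y *v y = \<Theta> *v (W *v y) + (\<Sum>k\<in>K. (x k \<bullet> y) *\<^sub>R \<eta> k)"
      by (simp add: Y_def W_def outer_sum_mult scaleR_add_right sum.distrib matrix_vector_mult_scaleR vec.sum)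
    hence E: "(Y ** matrix_inv W - \<Theta>) *v v = (\<Sum>k\<in>K. (x k \<bullet> y) *\<^sub>R \<eta> k)"
      by (simp add: matrix_vector_mult_diff_rdistrib matrix_vector_mul_assoc[symmetric] y_def[symmetric] v[symmetric])
    have "norm ((Y ** matrix_inv W - \<Theta>) *v v) \<le> T * sqrt S"
    proof (rule power2_le_imp_le)
      show "(norm ((Y ** matrix_inv W - \<Theta>) *v v))\<^sup>2 \<le> (T * sqrt S)\<^sup>2"
        unfolding E using upper[of y] S0 by (simp add: power_mult_distrib flip: S_def)
    qed (use T S0 in simp)
    \<comment> \<open>A self-bounding estimate: S = y \<bullet> v is at most |y| |v|, and |y| is at
      most sqrt (S / \<kappa>), so one factor sqrt S cancels.\<close>
    also have "sqrt S \<le> norm v / sqrt \<kappa>"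
    proof (cases "S = 0")
      case False
      have "S = y \<bullet> (W *v y)" by (simp only: S_def quad)
      also have "\<dots> = y \<bullet> v" by (simp only: v[symmetric])
      also have "\<dots> \<le> norm y * norm v" by (rule norm_cauchy_schwarz)
      also have "\<dots> \<le> (sqrt S / sqrt \<kappa>) * norm v"
      proof (rule mult_right_mono)
        have "(norm y)\<^sup>2 \<le> S / \<kappa>" using lower[of y] \<kappa> by (simp add: S_def field_simps)
        hence "norm y \<le> sqrt (S / \<kappa>)" by (rule real_le_rsqrt)
        thus "norm y \<le> sqrt S / sqrt \<kappa>" by (simp add: real_sqrt_divide)
      qed simp
      finally have "sqrt S * sqrt S \<le> sqrt S * (norm v / sqrt \<kappa>)" using S0 by simp
      thus ?thesis using False S0 by (subst (asm) mult_le_cancel_left_pos) auto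
    qed (use \<kappa> in simp)
    finally show "norm ((Y ** matrix_inv W - \<Theta>) *v v) \<le> T / sqrt \<kappa> * norm v"
      using T by (simp add: mult_left_mono)
  qed
qed

section \<open>Measurability of matrix operations\<close>

lemma borel_measurable_vecI:
  fixes f :: "'a \<Rightarrow> 'b::euclidean_space^'n"
  assumes "\<And>i. (\<lambda>\<omega>. f \<omega> $ i) \<in> borel_measurable M"
  shows "f \<in> borel_measurable M"
  using assms by (subst borel_measurable_euclidean_space) (auto simp: Basis_vec_def inner_axis)

lemma borel_measurable_vec_nth[measurable (raw)]:
  fixes f :: "'a \<Rightarrow> 'b::euclidean_space^'n"
  assumes "f \<in> borel_measurable M" shows "(\<lambda>\<omega>. f \<omega> $ i) \<in> borel_measurable M"
  by (intro measurable_compose[OF assms] borel_measurable_continuous_onI continuous_intros)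

text \<open>By Cramer's rule the entries of the inverse are quotients of determinants where the
  determinant is nonzero; on singular matrices \<open>matrix_inv\<close> is constant.\<close>

lemma borel_measurable_matrix_inv:
  "(matrix_inv :: real^'n^'n \<Rightarrow> real^'n^'n) \<in> borel_measurable borel"
proof -
  \<comment> \<open>The default value: for a singular matrix the choice in \<open>matrix_inv\<close>
    is made from an empty predicate, so it is the same unspecified matrix every time.\<close>
  define C :: "real^'n^'n" where "C = (SOME B. False)"
  define N :: "real^'n^'n \<Rightarrow> real^'n^'n" where
    "N A = (\<chi> i j. det (\<chi> a b. if b = i then axis j 1 $ a else A $ a $ b) / det A)" for A
  have det_m[measurable]: "(\<lambda>A. det (g A)) \<in> borel_measurable borel"
    if [measurable]: "g \<in> borel_measurable borel" for g :: "real^'n^'n \<Rightarrow> real^'n^'n"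
    unfolding det_def by measurable
  have inv: "matrix_inv A = (if det A = 0 then C else N A)" for A :: "real^'n^'n"
  proof (cases "det A = 0")
    case True
    hence "\<not> invertible A" by (simp add: invertible_det_nz)
    hence "(\<lambda>B. A ** B = mat 1 \<and> B ** A = mat 1) = (\<lambda>B. False)" by (auto simp: invertible_def)
    thus ?thesis using True by (simp add: matrix_inv_def C_def)
  next
    case False
    hence "invertible A" by (simp add: invertible_det_nz)
    hence r: "A ** matrix_inv A = mat 1" by (rule matrix_inv_inverse)
    have "matrix_inv A $ i $ j = N A $ i $ j" for i j
    proof -
      have "A *v (matrix_inv A *v axis j 1) = axis j 1"
        by (simp add: matrix_vector_mul_assoc r)
      hence "matrix_inv A *v axis j 1 = (\<chi> k. det (\<chi> a b. if b = k then axis j 1 $ a else A $ a $ b) / det A)"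
        using cramer[OF False] by blast
      moreover have "(matrix_inv A *v axis j 1) $ i = matrix_inv A $ i $ j"
        by (simp add: matrix_vector_mult_basis column_def)
      ultimately show ?thesis by (simp add: N_def)
    qed
    thus ?thesis using False by (simp add: vec_eq_iff)
  qed
  have [measurable]: "(\<lambda>A :: real^'n^'n. \<chi> a b. if b = i then axis j 1 $ a else A $ a $ b) \<in> borel_measurable borel" for i j :: 'n
    by (intro borel_measurable_vecI) (simp, measurable)
  have [measurable]: "N \<in> borel_measurable borel"
    unfolding N_def by (intro borel_measurable_vecI) (simp, measurable)
  show ?thesis unfolding inv[abs_def] by measurable
qed

text \<open>A sublevel set of the operator norm is an intersection of closed conditions, one for
  each vector. Being closed, it is Borel, which makes the event in the theorem measurable.\<close>

lemma closed_spec_norm_le: "closed {A :: real^'n^'m. spec_norm A \<le> C}"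
proof (cases "0 \<le> C")
  case True
  have "spec_norm A \<le> C \<longleftrightarrow> (\<forall>v. norm (A *v v) \<le> C * norm v)" for A :: "real^'n^'m"
  proof
    assume "spec_norm A \<le> C"
    show "\<forall>v. norm (A *v v) \<le> C * norm v"
      using onorm[OF matrix_vector_mul_bounded_linear, of A] \<open>spec_norm A \<le> C\<close>
      unfolding spec_norm_def by (meson mult_right_mono norm_ge_zero order_trans)
  qed (auto simp: spec_norm_def intro!: onorm_le)
  moreover have "continuous_on UNIV (\<lambda>A :: real^'n^'m. A *v v)" for v
    unfolding matrix_vector_mult_def by (intro continuous_intros)
  ultimately show ?thesis
    by (auto intro!: closed_Collect_all closed_Collect_le continuous_intros)
next
  case False
  have "\<not> spec_norm A \<le> C" for A :: "real^'n^'m"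
    using onorm_pos_le[OF matrix_vector_mul_bounded_linear, of A] False by (simp add: spec_norm_def)
  thus ?thesis by simp
qed

lemma borel_measurable_matrix_mult[measurable (raw)]:
  fixes A :: "'a \<Rightarrow> real^'n^'m" and B :: "'a \<Rightarrow> real^'k^'n"
  assumes [measurable]: "A \<in> borel_measurable M" "B \<in> borel_measurable M"
  shows "(\<lambda>\<omega>. A \<omega> ** B \<omega>) \<in> borel_measurable M"
  unfolding matrix_matrix_mult_def by (intro borel_measurable_vecI) (simp, measurable)

lemma borel_measurable_matrix_vector_mult[measurable (raw)]:
  fixes A :: "real^'n^'m"
  assumes [measurable]: "v \<in> borel_measurable M"
  shows "(\<lambda>\<omega>. A *v v \<omega>) \<in> borel_measurable M"
  unfolding matrix_vector_mult_def by (intro borel_measurable_vecI) (simp, measurable)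

lemma borel_measurable_outer[measurable (raw)]:
  fixes u :: "'a \<Rightarrow> real^'m" and v :: "'a \<Rightarrow> real^'n"
  assumes [measurable]: "u \<in> borel_measurable M" "v \<in> borel_measurable M"
  shows "(\<lambda>\<omega>. outer (u \<omega>) (v \<omega>)) \<in> borel_measurable M"
  unfolding outer_def by (intro borel_measurable_vecI) (simp, measurable)

section \<open>A union bound over the unit sphere of a norm\<close>

text \<open>\<open>lower\<close> makes the balls of \<open>p\<close> bounded, hence of finite
  volume; continuity makes them measurable and gives the unit ball an interior, hence positive
  volume. The size of \<alpha> does not appear in the bounds below, which compare volumes of
  concentric balls of the same norm.\<close>

locale vector_norm =
  fixes p :: "'b::euclidean_space \<Rightarrow> real" and \<alpha> :: real
  assumes triangle: "p (v + w) \<le> p v + p w"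
    and scale: "p (c *\<^sub>R v) = \<bar>c\<bar> * p v"
    and alpha_pos: "0 < \<alpha>"
    and lower: "\<alpha> * norm v \<le> p v"
    and cont: "continuous_on UNIV p"
begin

lemma zero: "p 0 = 0"
  using scale[of 0 0] by simp

lemma nonneg: "0 \<le> p v"
  using lower[of v] alpha_pos by (meson less_eq_real_def mult_nonneg_nonneg norm_ge_zero order_trans)

lemma minus: "p (- v) = p v"
  using scale[of "-1" v] by simp

lemma measurable_p[measurable]: "p \<in> borel_measurable borel"
  using cont by (rule borel_measurable_continuous_onI)

definition pball :: "real \<Rightarrow> 'b set" where "pball r = {w. p w \<le> r}"

lemma pball_borel[measurable]: "pball r \<in> sets borel"
  unfolding pball_def by measurable

definition V :: real where "V = measure lborel (pball 1)"

lemma emeasure_pball_finite: "emeasure lborel (pball r) < \<infinity>"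
proof -
  have "norm v \<le> r / \<alpha>" if "v \<in> pball r" for v
    using lower[of v] alpha_pos that by (simp add: pball_def field_simps)
  hence "pball r \<subseteq> cball 0 (r / \<alpha>)" by (auto simp: dist_norm)
  hence "bounded (pball r)" by (rule bounded_subset[rotated]) simp
  thus ?thesis by (rule emeasure_bounded_finite)
qed

lemma V_pos: "0 < V"
proof -
  have "open {w. p w < 1}" using cont by (intro open_Collect_less) auto
  moreover have "0 \<in> {w. p w < 1}" using zero by simp
  ultimately obtain e where e: "e > 0" "ball 0 e \<subseteq> {w. p w < 1}"
    by (meson open_contains_ball)
  hence "ball 0 e \<subseteq> pball 1" by (auto simp: pball_def)
  hence "measure lborel (ball (0::'b) e) \<le> V"
    unfolding V_def using emeasure_pball_finite[of 1] by (intro measure_mono_fmeasurable) (auto simp: fmeasurable_def)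
  moreover have "0 < measure lborel (ball (0::'b) e)"
    using content_ball_pos[OF e(1), of 0] by simp
  ultimately show ?thesis by linarith
qed

lemma emeasure_pball: assumes "0 < r" shows "emeasure lborel (pball r) = ennreal (r ^ DIM('b) * V)"
proof -
  have pre: "(\<lambda>x. 0 + r *\<^sub>R x) -` pball r = pball 1"
    using assms by (auto simp: pball_def scale)
  have "emeasure lborel (pball r) = emeasure (density (distr lborel borel (\<lambda>x::'b. 0 + r *\<^sub>R x)) (\<lambda>_. ennreal (\<bar>r\<bar> ^ DIM('b)))) (pball r)"
    by (subst lborel_affine[of r 0]) (use assms in auto)
  also have "\<dots> = ennreal (r ^ DIM('b)) * emeasure lborel (pball 1)"
    using assms by (subst emeasure_density_const) (auto simp: emeasure_distr pre[simplified])
  also have "\<dots> = ennreal (r ^ DIM('b) * V)"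
    using emeasure_pball_finite[of 1] V_pos assms unfolding V_def
    by (subst emeasure_eq_ennreal_measure) (auto simp: ennreal_mult' top.not_eq_extremum)
  finally show ?thesis .
qed

text \<open>Integrating \<open>F \<omega>\<close> over a shell replaces the usual covering net: the shell contains a small
  ball around every unit vector \<open>v\<close>, and pairing \<open>v + z\<close> with \<open>v - z\<close> bounds the integral over this
  ball from below by the AM-GM inequality.\<close>
lemma ball_union_bound:
  fixes F :: "'a \<Rightarrow> 'b \<Rightarrow> real"
  assumes M: "prob_space M"
    and e: "0 < e" and a: "0 < a" and b: "0 \<le> b"
    and meas[measurable]: "(\<lambda>(\<omega>, w). F \<omega> w) \<in> borel_measurable (M \<Otimes>\<^sub>M borel)"
    and nonneg_F: "\<And>\<omega> w. 0 \<le> F \<omega> w"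
    and bound: "\<And>w. 1 - e \<le> p w \<Longrightarrow> p w \<le> 1 + e \<Longrightarrow> (\<integral>\<^sup>+\<omega>. ennreal (F \<omega> w) \<partial>M) \<le> ennreal b"
  shows "\<exists>G\<in>sets M. measure M (space M - G) \<le> ((1 + e) / e) ^ DIM('b) * b / a \<and>
    (\<forall>\<omega>\<in>G. \<forall>v. p v = 1 \<longrightarrow> (\<exists>z. p z \<le> e \<and> F \<omega> (v + z) * F \<omega> (v - z) < a\<^sup>2))"
proof -
  interpret prob_space M by fact
  define S where "S = {w. 1 - e \<le> p w \<and> p w \<le> 1 + e}"
  have S[measurable]: "S \<in> sets borel" unfolding S_def by measurable
  define Z where "Z \<omega> = (\<integral>\<^sup>+w. ennreal (F \<omega> w) * indicator S w \<partial>lborel)" for \<omega>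
  have meas'[measurable]: "(\<lambda>(\<omega>, w). F \<omega> w) \<in> borel_measurable (M \<Otimes>\<^sub>M lborel)"
    using meas by (simp cong: measurable_cong_sets)
  have Z[measurable]: "Z \<in> borel_measurable M"
    unfolding Z_def by measurable
  \<comment> \<open>By Tonelli the pointwise moment bound integrates over the shell, which is
    enlarged to the full ball of radius \<open>1 + e\<close>.\<close>
  have EZ: "(\<integral>\<^sup>+\<omega>. Z \<omega> \<partial>M) \<le> ennreal (b * ((1 + e) ^ DIM('b) * V))"
  proof -
    interpret pair_sigma_finite M lborel ..
    have "(\<integral>\<^sup>+\<omega>. Z \<omega> \<partial>M) = (\<integral>\<^sup>+w. (\<integral>\<^sup>+\<omega>. ennreal (F \<omega> w) * indicator S w \<partial>M) \<partial>lborel)"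
      unfolding Z_def by (subst Fubini') auto
    also have "\<dots> \<le> (\<integral>\<^sup>+w. ennreal b * indicator (pball (1 + e)) w \<partial>lborel)"
    proof (rule nn_integral_mono)
      fix w
      show "(\<integral>\<^sup>+\<omega>. ennreal (F \<omega> w) * indicator S w \<partial>M) \<le> ennreal b * indicator (pball (1 + e)) w"
        using bound[of w] by (cases "w \<in> S") (auto simp: S_def pball_def)
    qed
    also have "\<dots> = ennreal b * emeasure lborel (pball (1 + e))"
      by (simp add: nn_integral_cmult_indicator)
    also have "\<dots> = ennreal (b * ((1 + e) ^ DIM('b) * V))"
      using e b by (subst emeasure_pball) (auto simp: ennreal_mult')
    finally show ?thesis .
  qed
  \<comment> \<open>This is \<open>a\<close> times the volume of \<open>pball e\<close>. Markov's
    inequality divides \<open>EZ\<close> by it, and \<open>V\<close> cancels.\<close>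
  define th where "th = a * (e ^ DIM('b) * V)"
  have th: "0 < th" unfolding th_def using a e V_pos by simp
  define B where "B = {\<omega>\<in>space M. 1 \<le> ennreal (1 / th) * Z \<omega>}"
  have B[measurable]: "B \<in> sets M" unfolding B_def by measurable
  have "emeasure M B \<le> ennreal (1 / th) * (\<integral>\<^sup>+\<omega>. Z \<omega> * indicator (space M) \<omega> \<partial>M)"
    unfolding B_def by (rule nn_integral_Markov_inequality) auto
  also have "(\<integral>\<^sup>+\<omega>. Z \<omega> * indicator (space M) \<omega> \<partial>M) = (\<integral>\<^sup>+\<omega>. Z \<omega> \<partial>M)"
    by (rule nn_integral_cong) auto
  also have "ennreal (1 / th) * \<dots> \<le> ennreal (1 / th) * ennreal (b * ((1 + e) ^ DIM('b) * V))"
    by (intro mult_left_mono EZ) auto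
  also have "\<dots> = ennreal ((1 / th) * (b * ((1 + e) ^ DIM('b) * V)))"
    using th by (subst ennreal_mult') auto
  also have "(1 / th) * (b * ((1 + e) ^ DIM('b) * V)) = ((1 + e) / e) ^ DIM('b) * b / a"
    using V_pos e by (simp add: th_def power_divide field_simps)
  finally have mB: "measure M B \<le> ((1 + e) / e) ^ DIM('b) * b / a"
    using e a b by (simp add: emeasure_eq_measure)
  show ?thesis
  proof (intro bexI[of _ "space M - B"] conjI ballI allI impI)
    show "measure M (space M - (space M - B)) \<le> ((1 + e) / e) ^ DIM('b) * b / a"
      using mB sets.sets_into_space[OF B] by (simp add: double_diff)
    show "space M - B \<in> sets M" by auto
    fix \<omega> v assume \<omega>: "\<omega> \<in> space M - B" and v: "p v = 1"
    show "\<exists>z. p z \<le> e \<and> F \<omega> (v + z) * F \<omega> (v - z) < a\<^sup>2"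
    proof (rule ccontr)
      assume neg: "\<not> ?thesis"
      have [measurable]: "F \<omega> \<in> borel_measurable borel"
        using measurable_Pair2[OF meas, of \<omega>] \<omega> by simp
      have sub: "v + z \<in> S" if "z \<in> pball e" for z
        using that triangle[of v z] triangle[of "v + z" "- z"] v minus[of z] by (auto simp: pball_def S_def)
      have sub': "v - z \<in> S" if "z \<in> pball e" for z
        using sub[of "- z"] that by (simp add: pball_def minus)
      \<comment> \<open>Lebesgue measure is invariant under both z -> v + z and z -> v - z, so
        \<open>Z\<close> dominates the integral over \<open>pball e\<close> in two ways; adding them
        gives the paired integrand.\<close>
      have inv: "(lborel :: 'b measure) = distr lborel borel ((+) v)" by (simp add: lborel_distr_plus)
      have inv': "(lborel :: 'b measure) = distr lborel borel (\<lambda>z. v + (-1) *\<^sub>R z)"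
        using lborel_affine[of "-1" v] by (simp add: density_1)
      have Z1: "Z \<omega> \<ge> (\<integral>\<^sup>+z. ennreal (F \<omega> (v + z)) * indicator (pball e) z \<partial>lborel)"
        unfolding Z_def by (subst (2) inv, subst nn_integral_distr)
          (auto intro!: nn_integral_mono simp: sub split: split_indicator)
      have Z2: "Z \<omega> \<ge> (\<integral>\<^sup>+z. ennreal (F \<omega> (v - z)) * indicator (pball e) z \<partial>lborel)"
        unfolding Z_def by (subst (2) inv', subst nn_integral_distr)
          (auto intro!: nn_integral_mono simp: sub' split: split_indicator)
      have pt: "2 * a \<le> F \<omega> (v + z) + F \<omega> (v - z)" if "z \<in> pball e" for z
      proof (rule power2_le_imp_le)
        have "a\<^sup>2 \<le> F \<omega> (v + z) * F \<omega> (v - z)" using neg that by (auto simp: pball_def not_less)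
        moreover have "4 * (F \<omega> (v + z) * F \<omega> (v - z)) \<le> (F \<omega> (v + z) + F \<omega> (v - z))\<^sup>2"
          using sum_squares_bound[of "F \<omega> (v + z)" "F \<omega> (v - z)"] by (simp add: power2_sum algebra_simps)
        ultimately show "(2 * a)\<^sup>2 \<le> (F \<omega> (v + z) + F \<omega> (v - z))\<^sup>2" by (simp add: power_mult_distrib)
        show "0 \<le> F \<omega> (v + z) + F \<omega> (v - z)" using nonneg_F by (simp add: add_nonneg_nonneg)
      qed
      have "ennreal (2 * th) = ennreal (2 * a) * emeasure lborel (pball e)"
        using a e unfolding th_def by (subst emeasure_pball) (auto simp: ennreal_mult'[symmetric] mult_ac)
      also have "\<dots> = (\<integral>\<^sup>+z. ennreal (2 * a) * indicator (pball e) z \<partial>lborel)"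
        by (simp add: nn_integral_cmult_indicator)
      also have "\<dots> \<le> (\<integral>\<^sup>+z. ennreal (F \<omega> (v + z)) * indicator (pball e) z + ennreal (F \<omega> (v - z)) * indicator (pball e) z \<partial>lborel)"
        by (intro nn_integral_mono) (auto split: split_indicator simp: ennreal_plus[symmetric] nonneg_F pt simp del: ennreal_plus intro!: ennreal_leI)
      also have "\<dots> = (\<integral>\<^sup>+z. ennreal (F \<omega> (v + z)) * indicator (pball e) z \<partial>lborel) + (\<integral>\<^sup>+z. ennreal (F \<omega> (v - z)) * indicator (pball e) z \<partial>lborel)"
        by (subst nn_integral_add) auto
      also have "\<dots> \<le> Z \<omega> + Z \<omega>" by (intro add_mono Z1 Z2)
      finally have le: "ennreal (2 * th) \<le> Z \<omega> + Z \<omega>" .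
      have "ennreal th \<le> Z \<omega>"
      proof (cases "Z \<omega>")
        case (real z)
        thus ?thesis using le th by (simp add: ennreal_plus[symmetric] del: ennreal_plus)
      qed simp
      hence "ennreal (1 / th) * ennreal th \<le> ennreal (1 / th) * Z \<omega>" by (rule mult_left_mono) simp
      moreover have "ennreal (1 / th) * ennreal th = 1" using th by (simp add: ennreal_mult'[symmetric])
      ultimately show False using \<omega> by (simp add: B_def)
    qed
  qed
qed

end

section \<open>Isotropic Gaussian vectors\<close>

lemma iso_gauss_density_prod:
  fixes mu v :: "real^'n"
  assumes "0 < \<sigma>"
  shows "iso_gauss_density mu \<sigma> v = (\<Prod>b\<in>Basis. normal_density (mu \<bullet> b) \<sigma> (v \<bullet> b))"
proof -
  have c: "(2 * pi * \<sigma>\<^sup>2) powr (- real CARD('n) / 2) = (1 / sqrt (2 * pi * \<sigma>\<^sup>2)) ^ CARD('n)"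
  proof -
    have pos: "0 < 2 * pi * \<sigma>\<^sup>2" using assms by simp
    have "(1 / sqrt (2 * pi * \<sigma>\<^sup>2)) ^ CARD('n) = ((2 * pi * \<sigma>\<^sup>2) powr (- (1/2))) powr real CARD('n)"
      using pos by (subst powr_realpow) (auto simp: powr_minus powr_half_sqrt inverse_eq_divide)
    thus ?thesis by (subst (asm) powr_powr) simp
  qed
  have n: "(norm (v - mu))\<^sup>2 = (\<Sum>b\<in>Basis. (v \<bullet> b - mu \<bullet> b)\<^sup>2)"
    by (subst power2_norm_eq_inner, subst euclidean_inner) (simp add: power2_eq_square inner_diff_left)
  have "(\<Prod>b\<in>(Basis :: (real^'n) set). normal_density (mu \<bullet> b) \<sigma> (v \<bullet> b)) =
    (1 / sqrt (2 * pi * \<sigma>\<^sup>2)) ^ CARD('n) * exp (\<Sum>b\<in>(Basis :: (real^'n) set). - (v \<bullet> b - mu \<bullet> b)\<^sup>2 / (2 * \<sigma>\<^sup>2))"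
    unfolding normal_density_def by (subst prod.distrib) (simp add: exp_sum)
  also have "(\<Sum>b\<in>(Basis :: (real^'n) set). - (v \<bullet> b - mu \<bullet> b)\<^sup>2 / (2 * \<sigma>\<^sup>2)) = - (norm (v - mu))\<^sup>2 / (2 * \<sigma>\<^sup>2)"
    by (simp add: n sum_negf sum_divide_distrib)
  finally show ?thesis by (simp only: iso_gauss_density_def c)
qed

lemma iso_gauss_density_nonneg: "0 \<le> iso_gauss_density mu \<sigma> v"
  by (simp add: iso_gauss_density_def)

lemma borel_measurable_iso_gauss_density[measurable]:
  "iso_gauss_density mu \<sigma> \<in> borel_measurable borel"
  unfolding iso_gauss_density_def by measurable

lemma nn_integral_normal_density:
  assumes "0 < \<sigma>" shows "(\<integral>\<^sup>+s. ennreal (normal_density a \<sigma> s) \<partial>lborel) = 1"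
  using prob_space.emeasure_space_1[OF prob_space_normal_density[OF assms, of a]]
  by (simp add: emeasure_density)

text \<open>Box integrals factor over the coordinates. Taking whole lines as sides gives total mass
  1; general sides give independence of the coordinates.\<close>

lemma nn_integral_iso_gauss:
  fixes mu :: "real^'n" and A :: "real^'n \<Rightarrow> real set"
  assumes "0 < \<sigma>" and [measurable]: "\<And>b. b \<in> Basis \<Longrightarrow> A b \<in> sets borel"
  shows "(\<integral>\<^sup>+v. ennreal (iso_gauss_density mu \<sigma> v) * indicator {v. \<forall>b\<in>Basis. v \<bullet> b \<in> A b} v \<partial>lborel) =
    (\<Prod>b\<in>Basis. \<integral>\<^sup>+s. ennreal (normal_density (mu \<bullet> b) \<sigma> s) * indicator (A b) s \<partial>lborel)"
proof -
  have "(\<Prod>b\<in>Basis. \<integral>\<^sup>+s. ennreal (normal_density (mu \<bullet> b) \<sigma> s) * indicator (A b) s \<partial>lborel) =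
    (\<integral>\<^sup>+v. (\<Prod>b\<in>Basis. ennreal (normal_density (mu \<bullet> b) \<sigma> (v \<bullet> b)) * indicator (A b) (v \<bullet> b)) \<partial>lborel)"
    by (rule nn_integral_lborel_prod[symmetric]) auto
  also have "\<dots> = (\<integral>\<^sup>+v. ennreal (iso_gauss_density mu \<sigma> v) * indicator {v. \<forall>b\<in>Basis. v \<bullet> b \<in> A b} v \<partial>lborel)"
  proof (rule nn_integral_cong)
    fix v :: "real^'n"
    have "(\<Prod>b\<in>Basis. indicator (A b) (v \<bullet> b)) = (indicator {v. \<forall>b\<in>Basis. v \<bullet> b \<in> A b} v :: ennreal)"
      by (auto simp: indicator_def)
    thus "(\<Prod>b\<in>Basis. ennreal (normal_density (mu \<bullet> b) \<sigma> (v \<bullet> b)) * indicator (A b) (v \<bullet> b)) =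
      ennreal (iso_gauss_density mu \<sigma> v) * indicator {v. \<forall>b\<in>Basis. v \<bullet> b \<in> A b} v"
      by (simp add: prod.distrib iso_gauss_density_prod[OF assms(1)] prod_ennreal)
  qed
  finally show ?thesis by simp
qed

lemma nn_integral_iso_gauss_1:
  assumes "0 < \<sigma>" shows "(\<integral>\<^sup>+v. ennreal (iso_gauss_density (mu :: real^'n) \<sigma> v) \<partial>lborel) = 1"
  using nn_integral_iso_gauss[OF assms, of "\<lambda>_. UNIV" mu] by (simp add: nn_integral_normal_density[OF assms])

lemma prob_space_iso_gauss:
  assumes "0 < \<sigma>" shows "prob_space (density lborel (iso_gauss_density (mu :: real^'n) \<sigma>))"
  by (rule prob_spaceI) (simp add: emeasure_density nn_integral_iso_gauss_1[OF assms])

lemma (in prob_space) iso_gauss_coordinates: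
  fixes X :: "'a \<Rightarrow> real^'n"
  assumes X: "distributed M lborel X (\<lambda>v. ennreal (iso_gauss_density mu \<sigma> v))" and \<sigma>: "0 < \<sigma>"
  shows "indep_vars (\<lambda>_. borel) (\<lambda>b \<omega>. X \<omega> \<bullet> b) Basis"
    and "b \<in> Basis \<Longrightarrow> distributed M lborel (\<lambda>\<omega>. X \<omega> \<bullet> b) (normal_density (mu \<bullet> b) \<sigma>)"
proof -
  have [measurable]: "X \<in> borel_measurable M" using distributed_measurable[OF X] by simp
  have box: "emeasure M (X -` {v. \<forall>b\<in>Basis. v \<bullet> b \<in> A b} \<inter> space M) =
    (\<Prod>b\<in>Basis. \<integral>\<^sup>+s. ennreal (normal_density (mu \<bullet> b) \<sigma> s) * indicator (A b) s \<partial>lborel)"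
    if [measurable]: "\<And>b. b \<in> Basis \<Longrightarrow> A b \<in> sets borel" for A
  proof -
    have "(\<integral>\<^sup>+v. ennreal (iso_gauss_density mu \<sigma> v) * indicator {v. \<forall>b\<in>Basis. v \<bullet> b \<in> A b} v \<partial>lborel) =
      emeasure M (X -` {v. \<forall>b\<in>Basis. v \<bullet> b \<in> A b} \<inter> space M)"
      by (subst distributed_emeasure[OF X]) (auto intro!: measurable_sets_borel)
    thus ?thesis using nn_integral_iso_gauss[OF \<sigma>, of A mu] that by simp
  qed
  have one: "emeasure M ((\<lambda>\<omega>. X \<omega> \<bullet> b) -` B \<inter> space M) =
      (\<integral>\<^sup>+s. ennreal (normal_density (mu \<bullet> b) \<sigma> s) * indicator B s \<partial>lborel)"
    if b: "b \<in> Basis" and [measurable]: "B \<in> sets borel" for b B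
  proof -
    \<comment> \<open>The law of a single coordinate comes from a box whose other sides are whole
      lines and contribute factors 1.\<close>
    let ?A = "\<lambda>b'. if b' = b then B else UNIV"
    have "(\<lambda>\<omega>. X \<omega> \<bullet> b) -` B \<inter> space M = X -` {v. \<forall>b'\<in>Basis. v \<bullet> b' \<in> ?A b'} \<inter> space M"
      using b by auto
    also have "emeasure M \<dots> = (\<Prod>b'\<in>Basis. \<integral>\<^sup>+s. ennreal (normal_density (mu \<bullet> b') \<sigma> s) * indicator (?A b') s \<partial>lborel)"
      by (rule box) auto
    also have "\<dots> = (\<Prod>b'\<in>Basis. if b' = b then (\<integral>\<^sup>+s. ennreal (normal_density (mu \<bullet> b) \<sigma> s) * indicator B s \<partial>lborel) else 1)"
      by (rule prod.cong) (auto simp: nn_integral_normal_density[OF \<sigma>])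
    also have "\<dots> = (\<integral>\<^sup>+s. ennreal (normal_density (mu \<bullet> b) \<sigma> s) * indicator B s \<partial>lborel)"
      using b by simp
    finally show ?thesis .
  qed
  show "distributed M lborel (\<lambda>\<omega>. X \<omega> \<bullet> b) (normal_density (mu \<bullet> b) \<sigma>)" if b: "b \<in> Basis" for b
    unfolding distributed_def
  proof (intro conjI measure_eqI)
    fix B assume "B \<in> sets (distr M lborel (\<lambda>\<omega>. X \<omega> \<bullet> b))"
    hence [measurable]: "B \<in> sets borel" by simp
    show "emeasure (distr M lborel (\<lambda>\<omega>. X \<omega> \<bullet> b)) B = emeasure (density lborel (\<lambda>x. ennreal (normal_density (mu \<bullet> b) \<sigma> x))) B"
      by (simp add: emeasure_distr emeasure_density one[OF b])
  qed auto
  show "indep_vars (\<lambda>_. borel) (\<lambda>b \<omega>. X \<omega> \<bullet> b) Basis"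
  proof (subst indep_vars_finite[where E = "\<lambda>_. sets borel"])
    show "\<forall>A\<in>Basis \<rightarrow> sets borel. prob (\<Inter>b\<in>Basis. (\<lambda>\<omega>. X \<omega> \<bullet> b) -` A b \<inter> space M) =
      (\<Prod>b\<in>Basis. prob ((\<lambda>\<omega>. X \<omega> \<bullet> b) -` A b \<inter> space M))"
    proof
      fix A :: "real^'n \<Rightarrow> real set" assume A: "A \<in> Basis \<rightarrow> sets borel"
      have "(\<Inter>b\<in>Basis. (\<lambda>\<omega>. X \<omega> \<bullet> b) -` A b \<inter> space M) = X -` {v. \<forall>b\<in>Basis. v \<bullet> b \<in> A b} \<inter> space M"
        by auto
      also have "emeasure M \<dots> = (\<Prod>b\<in>Basis. emeasure M ((\<lambda>\<omega>. X \<omega> \<bullet> b) -` A b \<inter> space M))"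
        using A by (subst box) (auto intro!: prod.cong one[symmetric])
      finally have "ennreal (prob (\<Inter>b\<in>Basis. (\<lambda>\<omega>. X \<omega> \<bullet> b) -` A b \<inter> space M)) =
        ennreal (\<Prod>b\<in>Basis. prob ((\<lambda>\<omega>. X \<omega> \<bullet> b) -` A b \<inter> space M))"
        by (simp add: emeasure_eq_measure prod_ennreal)
      thus "prob (\<Inter>b\<in>Basis. (\<lambda>\<omega>. X \<omega> \<bullet> b) -` A b \<inter> space M) =
        (\<Prod>b\<in>Basis. prob ((\<lambda>\<omega>. X \<omega> \<bullet> b) -` A b \<inter> space M))"
        by (simp add: prod_nonneg)
    qed
  qed (auto simp: sets.sigma_sets_eq[of borel, simplified] Int_stable_def)
qed

lemma (in prob_space) iso_gauss_inner:
  fixes X :: "'a \<Rightarrow> real^'n"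
  assumes X: "distributed M lborel X (\<lambda>v. ennreal (iso_gauss_density mu \<sigma> v))" and \<sigma>: "0 < \<sigma>"
    and w: "w \<noteq> 0"
  shows "distributed M lborel (\<lambda>\<omega>. X \<omega> \<bullet> w) (normal_density (mu \<bullet> w) (\<sigma> * norm w))"
proof -
  \<comment> \<open>Coordinates where \<open>w\<close> vanishes are dropped, because
    \<open>sum_indep_normal\<close> requires every summand to have positive standard
    deviation.\<close>
  define I where "I = {b \<in> Basis. w \<bullet> b \<noteq> 0}"
  have fin: "finite I" by (simp add: I_def)
  have ne: "I \<noteq> {}" using w euclidean_all_zero_iff[of w] by (auto simp: I_def)
  have inner_I: "u \<bullet> w = (\<Sum>b\<in>I. (w \<bullet> b) * (u \<bullet> b))" for u
    unfolding euclidean_inner[of u w] I_def by (intro sum.mono_neutral_cong_right) (auto simp: mult.commute)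
  have "indep_vars (\<lambda>_. borel) (\<lambda>b \<omega>. (w \<bullet> b) * (X \<omega> \<bullet> b)) Basis"
    using indep_vars_compose2[OF iso_gauss_coordinates(1)[OF X \<sigma>], of "\<lambda>b s. (w \<bullet> b) * s" "\<lambda>_. borel"] by simp
  hence ind: "indep_vars (\<lambda>_. borel) (\<lambda>b \<omega>. (w \<bullet> b) * (X \<omega> \<bullet> b)) I"
    by (rule indep_vars_subset) (auto simp: I_def)
  have "distributed M lborel (\<lambda>\<omega>. \<Sum>b\<in>I. (w \<bullet> b) * (X \<omega> \<bullet> b))
     (normal_density (\<Sum>b\<in>I. (w \<bullet> b) * (mu \<bullet> b)) (sqrt (\<Sum>b\<in>I. (\<bar>w \<bullet> b\<bar> * \<sigma>)\<^sup>2)))"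
  proof (rule sum_indep_normal[OF fin ne ind])
    fix b assume b: "b \<in> I"
    show "0 < \<bar>w \<bullet> b\<bar> * \<sigma>" using b \<sigma> by (simp add: I_def)
    show "distributed M lborel (\<lambda>\<omega>. (w \<bullet> b) * (X \<omega> \<bullet> b)) (normal_density ((w \<bullet> b) * (mu \<bullet> b)) (\<bar>w \<bullet> b\<bar> * \<sigma>))"
      using normal_density_affine[OF iso_gauss_coordinates(2)[OF X \<sigma>, of b] \<sigma>, of "w \<bullet> b" 0] b by (simp add: I_def)
  qed
  moreover have "sqrt (\<Sum>b\<in>I. (\<bar>w \<bullet> b\<bar> * \<sigma>)\<^sup>2) = \<sigma> * norm w"
  proof -
    have "(\<Sum>b\<in>I. (\<bar>w \<bullet> b\<bar> * \<sigma>)\<^sup>2) = (w \<bullet> w) * \<sigma>\<^sup>2"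
      by (simp add: inner_I[of w] sum_distrib_right power_mult_distrib flip: power2_eq_square)
    thus ?thesis using \<sigma> by (simp add: real_sqrt_mult norm_eq_sqrt_inner)
  qed
  ultimately show ?thesis by (simp add: inner_I)
qed

section \<open>Exponential moments of Gaussian vectors\<close>

lemma normal_exp_square:
  assumes \<rho>: "0 < \<rho>" and D: "0 < 1 - 2 * \<tau> * \<rho>\<^sup>2"
  shows "(\<integral>\<^sup>+s. ennreal (normal_density a \<rho> s) * ennreal (exp (\<tau> * s\<^sup>2)) \<partial>lborel) =
    ennreal (1 / sqrt (1 - 2 * \<tau> * \<rho>\<^sup>2) * exp (\<tau> * a\<^sup>2 / (1 - 2 * \<tau> * \<rho>\<^sup>2)))"
proof -
  define D where "D = 1 - 2 * \<tau> * \<rho>\<^sup>2"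
  have D0: "0 < D" using D by (simp add: D_def)
  have \<tau>: "\<tau> = (1 - D) / (2 * \<rho>\<^sup>2)" using \<rho> by (simp add: D_def)
  have "normal_density a \<rho> s * exp (\<tau> * s\<^sup>2) =
    (1 / sqrt D * exp (\<tau> * a\<^sup>2 / D)) * normal_density (a / D) (\<rho> / sqrt D) s" for s
  proof -
    \<comment> \<open>Completing the square: the tilted density is again normal, with mean
      \<open>a / D\<close> and deviation \<open>\<rho> / sqrt D\<close>. The parameter \<tau> may be
      negative, which serves the lower tail.\<close>
    have "- (s - a)\<^sup>2 / (2 * \<rho>\<^sup>2) + \<tau> * s\<^sup>2 = \<tau> * a\<^sup>2 / D + - (s - a / D)\<^sup>2 / (2 * (\<rho> / sqrt D)\<^sup>2)"
      using D0 \<rho> unfolding \<tau> by (simp add: power_divide divide_simps) (simp add: power2_eq_square power4_eq_xxxx algebra_simps)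
    hence "exp (- (s - a)\<^sup>2 / (2 * \<rho>\<^sup>2)) * exp (\<tau> * s\<^sup>2) = exp (\<tau> * a\<^sup>2 / D) * exp (- (s - a / D)\<^sup>2 / (2 * (\<rho> / sqrt D)\<^sup>2))"
      by (simp only: exp_add[symmetric])
    moreover have "1 / sqrt (2 * pi * \<rho>\<^sup>2) = 1 / sqrt D * (1 / sqrt (2 * pi * (\<rho> / sqrt D)\<^sup>2))"
      using D0 \<rho> by (simp add: power_divide real_sqrt_mult real_sqrt_divide)
    ultimately show ?thesis unfolding normal_density_def by (simp add: mult_ac)
  qed
  hence "(\<integral>\<^sup>+s. ennreal (normal_density a \<rho> s) * ennreal (exp (\<tau> * s\<^sup>2)) \<partial>lborel) =
    (\<integral>\<^sup>+s. ennreal (1 / sqrt D * exp (\<tau> * a\<^sup>2 / D)) * ennreal (normal_density (a / D) (\<rho> / sqrt D) s) \<partial>lborel)"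
    using D0 by (intro nn_integral_cong) (simp add: ennreal_mult'[symmetric])
  also have "\<dots> = ennreal (1 / sqrt D * exp (\<tau> * a\<^sup>2 / D))"
    using D0 \<rho> by (simp add: nn_integral_cmult nn_integral_normal_density)
  finally show ?thesis by (simp add: D_def)
qed

lemma normal_exp_linear:
  assumes \<rho>: "0 < \<rho>"
  shows "(\<integral>\<^sup>+s. ennreal (normal_density 0 \<rho> s) * ennreal (exp s) \<partial>lborel) = ennreal (exp (\<rho>\<^sup>2 / 2))"
proof -
  have "normal_density 0 \<rho> s * exp s = exp (\<rho>\<^sup>2 / 2) * normal_density (\<rho>\<^sup>2) \<rho> s" for s
  proof -
    have "- s\<^sup>2 / (2 * \<rho>\<^sup>2) + s = \<rho>\<^sup>2 / 2 + - (s - \<rho>\<^sup>2)\<^sup>2 / (2 * \<rho>\<^sup>2)"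
      using \<rho> by (simp add: divide_simps) (simp add: power2_eq_square power4_eq_xxxx algebra_simps)
    hence "exp (- s\<^sup>2 / (2 * \<rho>\<^sup>2)) * exp s = exp (\<rho>\<^sup>2 / 2) * exp (- (s - \<rho>\<^sup>2)\<^sup>2 / (2 * \<rho>\<^sup>2))"
      by (simp only: exp_add[symmetric])
    thus ?thesis unfolding normal_density_def by (simp add: mult_ac)
  qed
  hence "(\<integral>\<^sup>+s. ennreal (normal_density 0 \<rho> s) * ennreal (exp s) \<partial>lborel) =
    (\<integral>\<^sup>+s. ennreal (exp (\<rho>\<^sup>2 / 2)) * ennreal (normal_density (\<rho>\<^sup>2) \<rho> s) \<partial>lborel)"
    by (intro nn_integral_cong) (simp add: ennreal_mult'[symmetric])
  thus ?thesis using \<rho> by (simp add: nn_integral_cmult nn_integral_normal_density)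
qed

context prob_space
begin

lemma iso_gauss_exp_inner_square:
  fixes X :: "'a \<Rightarrow> real^'n"
  assumes X: "distributed M lborel X (\<lambda>v. ennreal (iso_gauss_density mu \<sigma> v))" and \<sigma>: "0 < \<sigma>"
    and D: "0 < 1 - 2 * \<tau> * (\<sigma> * norm w)\<^sup>2"
  shows "(\<integral>\<^sup>+\<omega>. ennreal (exp (\<tau> * (X \<omega> \<bullet> w)\<^sup>2)) \<partial>M) =
    ennreal (1 / sqrt (1 - 2 * \<tau> * (\<sigma> * norm w)\<^sup>2) * exp (\<tau> * (mu \<bullet> w)\<^sup>2 / (1 - 2 * \<tau> * (\<sigma> * norm w)\<^sup>2)))"
proof (cases "w = 0")
  case True thus ?thesis by (simp add: emeasure_space_1)
next
  case False
  have "(\<integral>\<^sup>+\<omega>. ennreal (exp (\<tau> * (X \<omega> \<bullet> w)\<^sup>2)) \<partial>M) =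
    (\<integral>\<^sup>+s. ennreal (normal_density (mu \<bullet> w) (\<sigma> * norm w) s) * ennreal (exp (\<tau> * s\<^sup>2)) \<partial>lborel)"
    by (rule distributed_nn_integral[OF iso_gauss_inner[OF X \<sigma> False], symmetric]) auto
  thus ?thesis using False \<sigma> D by (simp add: normal_exp_square)
qed

lemma iso_gauss_exp_inner:
  fixes X :: "'a \<Rightarrow> real^'n"
  assumes X: "distributed M lborel X (\<lambda>v. ennreal (iso_gauss_density 0 \<sigma> v))" and \<sigma>: "0 < \<sigma>"
  shows "(\<integral>\<^sup>+\<omega>. ennreal (exp (X \<omega> \<bullet> w)) \<partial>M) = ennreal (exp ((\<sigma> * norm w)\<^sup>2 / 2))"
proof (cases "w = 0")
  case True thus ?thesis by (simp add: emeasure_space_1)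
next
  case False
  have "(\<integral>\<^sup>+\<omega>. ennreal (exp (X \<omega> \<bullet> w)) \<partial>M) =
    (\<integral>\<^sup>+s. ennreal (normal_density (0 \<bullet> w) (\<sigma> * norm w) s) * ennreal (exp s) \<partial>lborel)"
    by (rule distributed_nn_integral[OF iso_gauss_inner[OF X \<sigma> False], symmetric]) auto
  thus ?thesis using False \<sigma> by (simp add: normal_exp_linear)
qed

lemma iso_gauss_exp_norm:
  fixes X :: "'a \<Rightarrow> real^'n"
  assumes X: "distributed M lborel X (\<lambda>v. ennreal (iso_gauss_density 0 \<sigma> v))" and \<sigma>: "0 < \<sigma>"
    and D: "0 < 1 - 2 * \<tau> * \<sigma>\<^sup>2"
  shows "(\<integral>\<^sup>+\<omega>. ennreal (exp (\<tau> * (norm (X \<omega>))\<^sup>2)) \<partial>M) = ennreal ((1 / sqrt (1 - 2 * \<tau> * \<sigma>\<^sup>2)) ^ CARD('n))"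
proof -
  have "indep_vars (\<lambda>_. borel) (\<lambda>b \<omega>. ennreal (exp (\<tau> * (X \<omega> \<bullet> b)\<^sup>2))) Basis"
    using indep_vars_compose2[OF iso_gauss_coordinates(1)[OF X \<sigma>], of "\<lambda>b s. ennreal (exp (\<tau> * s\<^sup>2))" "\<lambda>_. borel"] by simp
  moreover have "ennreal (exp (\<tau> * (norm (X \<omega>))\<^sup>2)) = (\<Prod>b\<in>Basis. ennreal (exp (\<tau> * (X \<omega> \<bullet> b)\<^sup>2)))" for \<omega>
  proof -
    have "(norm (X \<omega>))\<^sup>2 = (\<Sum>b\<in>Basis. (X \<omega> \<bullet> b)\<^sup>2)"
      by (subst power2_norm_eq_inner, subst euclidean_inner) (simp add: power2_eq_square)
    thus ?thesis by (simp add: sum_distrib_left exp_sum prod_ennreal)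
  qed
  ultimately have "(\<integral>\<^sup>+\<omega>. ennreal (exp (\<tau> * (norm (X \<omega>))\<^sup>2)) \<partial>M) =
    (\<Prod>b\<in>(Basis :: (real^'n) set). \<integral>\<^sup>+\<omega>. ennreal (exp (\<tau> * (X \<omega> \<bullet> b)\<^sup>2)) \<partial>M)"
    by (simp add: indep_vars_nn_integral)
  also have "\<dots> = (\<Prod>b\<in>(Basis :: (real^'n) set). ennreal (1 / sqrt (1 - 2 * \<tau> * \<sigma>\<^sup>2)))"
    by (intro prod.cong refl, subst iso_gauss_exp_inner_square[OF X \<sigma>]) (use D in auto)
  also have "\<dots> = ennreal ((1 / sqrt (1 - 2 * \<tau> * \<sigma>\<^sup>2)) ^ CARD('n))"
    using D by (simp add: ennreal_power)
  finally show ?thesis .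
qed

lemma iso_gauss_family_exp_square:
  fixes X :: "'k \<Rightarrow> 'a \<Rightarrow> real^'n"
  assumes X: "\<And>k. k \<in> K \<Longrightarrow> distributed M lborel (X k) (\<lambda>v. ennreal (iso_gauss_density (mu k) \<sigma> v))"
    and ind: "indep_vars (\<lambda>_. borel) X K" and K: "finite K" and \<sigma>: "0 < \<sigma>"
    and D: "0 < 1 - 2 * \<tau> * (\<sigma> * norm w)\<^sup>2"
  shows "(\<integral>\<^sup>+\<omega>. ennreal (exp (\<tau> * (\<Sum>k\<in>K. (X k \<omega> \<bullet> w)\<^sup>2))) \<partial>M) =
    ennreal ((1 / sqrt (1 - 2 * \<tau> * (\<sigma> * norm w)\<^sup>2)) ^ card K *
      exp (\<tau> * (\<Sum>k\<in>K. (mu k \<bullet> w)\<^sup>2) / (1 - 2 * \<tau> * (\<sigma> * norm w)\<^sup>2)))"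
proof -
  define D where "D = 1 - 2 * \<tau> * (\<sigma> * norm w)\<^sup>2"
  have "indep_vars (\<lambda>_. borel) (\<lambda>k \<omega>. ennreal (exp (\<tau> * (X k \<omega> \<bullet> w)\<^sup>2))) K"
    using indep_vars_compose2[OF ind, of "\<lambda>k v. ennreal (exp (\<tau> * (v \<bullet> w)\<^sup>2))" "\<lambda>_. borel"] by simp
  moreover have "ennreal (exp (\<tau> * (\<Sum>k\<in>K. (X k \<omega> \<bullet> w)\<^sup>2))) = (\<Prod>k\<in>K. ennreal (exp (\<tau> * (X k \<omega> \<bullet> w)\<^sup>2)))" for \<omega>
    using K by (simp add: sum_distrib_left exp_sum prod_ennreal)
  ultimately have "(\<integral>\<^sup>+\<omega>. ennreal (exp (\<tau> * (\<Sum>k\<in>K. (X k \<omega> \<bullet> w)\<^sup>2))) \<partial>M) =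
    (\<Prod>k\<in>K. \<integral>\<^sup>+\<omega>. ennreal (exp (\<tau> * (X k \<omega> \<bullet> w)\<^sup>2)) \<partial>M)"
    using K by (simp add: indep_vars_nn_integral)
  also have "\<dots> = (\<Prod>k\<in>K. ennreal (1 / sqrt D * exp (\<tau> * (mu k \<bullet> w)\<^sup>2 / D)))"
    using D unfolding D_def by (intro prod.cong refl iso_gauss_exp_inner_square[OF X \<sigma>]) auto
  also have "\<dots> = ennreal ((1 / sqrt D) ^ card K * exp (\<tau> * (\<Sum>k\<in>K. (mu k \<bullet> w)\<^sup>2) / D))"
    using D K by (subst prod_ennreal) (auto simp: D_def[symmetric] prod_dividef power_divide exp_sum sum_distrib_left sum_divide_distrib)
  finally show ?thesis by (simp add: D_def)
qed

text \<open>The norm of a Gaussian vector is linearised by an auxiliary standard Gaussian \<open>u\<close>: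
  \<open>exp (\<tau> |z|^2)\<close> is the mean of \<open>exp (sqrt (2 \<tau>) u \<bullet> z)\<close>.\<close>
lemma iso_gauss_family_exp_norm:
  fixes H :: "'k \<Rightarrow> 'a \<Rightarrow> real^'l"
  assumes H: "\<And>k. k \<in> K \<Longrightarrow> distributed M lborel (H k) (\<lambda>v. ennreal (iso_gauss_density 0 \<sigma> v))"
    and ind: "indep_vars (\<lambda>_. borel) H K" and K: "finite K" and \<sigma>: "0 < \<sigma>" and \<tau>: "0 \<le> \<tau>"
    and D: "0 < 1 - 2 * \<tau> * (\<Sum>k\<in>K. (c k)\<^sup>2)"
  shows "(\<integral>\<^sup>+\<omega>. ennreal (exp (\<tau> / \<sigma>\<^sup>2 * (norm (\<Sum>k\<in>K. c k *\<^sub>R H k \<omega>))\<^sup>2)) \<partial>M) =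
    ennreal ((1 / sqrt (1 - 2 * \<tau> * (\<Sum>k\<in>K. (c k)\<^sup>2))) ^ CARD('l))"
proof -
  define \<gamma> where "\<gamma> = density lborel (iso_gauss_density (0::real^'l) 1)"
  interpret G: prob_space \<gamma> unfolding \<gamma>_def by (rule prob_space_iso_gauss) simp
  have dist: "distributed \<gamma> lborel (\<lambda>u. u) (\<lambda>v. ennreal (iso_gauss_density 0 1 v))"
    unfolding distributed_def \<gamma>_def by (auto simp: distr_id2)
  have [measurable_cong]: "sets \<gamma> = sets borel" by (simp add: \<gamma>_def)
  have Hm[measurable]: "k \<in> K \<Longrightarrow> H k \<in> borel_measurable M" for k
    using distributed_measurable[OF H] by simp
  \<comment> \<open>Chosen so that the mean of exp (u \<bullet> s z), which is exp (s^2 |z|^2 / 2),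
    equals exp (\<tau> |z|^2 / \<sigma>^2).\<close>
  define s where "s = sqrt (2 * \<tau>) / \<sigma>"
  have s2: "s\<^sup>2 = 2 * \<tau> / \<sigma>\<^sup>2" using \<tau> by (simp add: s_def power_divide)
  have lin: "ennreal (exp (\<tau> / \<sigma>\<^sup>2 * (norm z)\<^sup>2)) = (\<integral>\<^sup>+u. ennreal (exp (u \<bullet> (s *\<^sub>R z))) \<partial>\<gamma>)" for z :: "real^'l"
    by (subst G.iso_gauss_exp_inner[OF dist]) (simp_all add: power_mult_distrib s2)
  interpret pair_sigma_finite M \<gamma> ..
  have "(\<integral>\<^sup>+\<omega>. ennreal (exp (\<tau> / \<sigma>\<^sup>2 * (norm (\<Sum>k\<in>K. c k *\<^sub>R H k \<omega>))\<^sup>2)) \<partial>M) =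
    (\<integral>\<^sup>+\<omega>. \<integral>\<^sup>+u. ennreal (exp (u \<bullet> (s *\<^sub>R (\<Sum>k\<in>K. c k *\<^sub>R H k \<omega>)))) \<partial>\<gamma> \<partial>M)"
    by (simp only: lin)
  \<comment> \<open>For fixed \<open>u\<close> the exponent is linear in the \<open>H k\<close>, so
    independence factors the inner integral. What is left is a moment of |u|^2 for a standard
    Gaussian in dimension \<open>CARD('l)\<close>.\<close>
  also have "\<dots> = (\<integral>\<^sup>+u. \<integral>\<^sup>+\<omega>. ennreal (exp (u \<bullet> (s *\<^sub>R (\<Sum>k\<in>K. c k *\<^sub>R H k \<omega>)))) \<partial>M \<partial>\<gamma>)"
    by (rule Fubini'[symmetric]) measurable
  also have "\<dots> = (\<integral>\<^sup>+u. ennreal (exp ((\<tau> * (\<Sum>k\<in>K. (c k)\<^sup>2)) * (norm u)\<^sup>2)) \<partial>\<gamma>)"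
  proof (rule nn_integral_cong)
    fix u :: "real^'l"
    have "indep_vars (\<lambda>_. borel) (\<lambda>k \<omega>. ennreal (exp (H k \<omega> \<bullet> ((s * c k) *\<^sub>R u)))) K"
      using indep_vars_compose2[OF ind, of "\<lambda>k v. ennreal (exp (v \<bullet> ((s * c k) *\<^sub>R u)))" "\<lambda>_. borel"] by simp
    moreover have "ennreal (exp (u \<bullet> (s *\<^sub>R (\<Sum>k\<in>K. c k *\<^sub>R H k \<omega>)))) = (\<Prod>k\<in>K. ennreal (exp (H k \<omega> \<bullet> ((s * c k) *\<^sub>R u))))" for \<omega>
      using K by (simp add: prod_ennreal exp_sum[symmetric] inner_sum_right inner_commute sum_distrib_left mult_ac)
    ultimately have "(\<integral>\<^sup>+\<omega>. ennreal (exp (u \<bullet> (s *\<^sub>R (\<Sum>k\<in>K. c k *\<^sub>R H k \<omega>)))) \<partial>M) =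
      (\<Prod>k\<in>K. \<integral>\<^sup>+\<omega>. ennreal (exp (H k \<omega> \<bullet> ((s * c k) *\<^sub>R u))) \<partial>M)"
      using K by (simp add: indep_vars_nn_integral)
    also have "\<dots> = (\<Prod>k\<in>K. ennreal (exp (\<tau> * (c k)\<^sup>2 * (norm u)\<^sup>2)))"
    proof (intro prod.cong refl)
      fix k assume "k \<in> K"
      have "(\<sigma> * norm ((s * c k) *\<^sub>R u))\<^sup>2 / 2 = \<tau> * (c k)\<^sup>2 * (norm u)\<^sup>2"
        using \<sigma> by (simp add: power_mult_distrib s2)
      thus "(\<integral>\<^sup>+\<omega>. ennreal (exp (H k \<omega> \<bullet> ((s * c k) *\<^sub>R u))) \<partial>M) = ennreal (exp (\<tau> * (c k)\<^sup>2 * (norm u)\<^sup>2))"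
        by (simp only: iso_gauss_exp_inner[OF H[OF \<open>k \<in> K\<close>] \<sigma>])
    qed
    also have "\<dots> = ennreal (exp ((\<tau> * (\<Sum>k\<in>K. (c k)\<^sup>2)) * (norm u)\<^sup>2))"
      using K by (simp add: prod_ennreal exp_sum[symmetric] sum_distrib_left sum_distrib_right)
    finally show "(\<integral>\<^sup>+\<omega>. ennreal (exp (u \<bullet> (s *\<^sub>R (\<Sum>k\<in>K. c k *\<^sub>R H k \<omega>)))) \<partial>M) =
      ennreal (exp ((\<tau> * (\<Sum>k\<in>K. (c k)\<^sup>2)) * (norm u)\<^sup>2))" .
  qed
  also have "\<dots> = ennreal ((1 / sqrt (1 - 2 * \<tau> * (\<Sum>k\<in>K. (c k)\<^sup>2))) ^ CARD('l))"
    by (subst G.iso_gauss_exp_norm[OF dist]) (use D in \<open>auto simp: mult_ac\<close>)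
  finally show ?thesis .
qed

end

section \<open>Independence of design and noise\<close>

context prob_space
begin

text \<open>Independence inside a pair is encoded in the product form of the joint density;
  integrating one factor out leaves the other. It complements the independence between different
  pairs, which is a separate hypothesis of the theorem.\<close>

lemma iso_gauss_pair_marginals:
  fixes X :: "'a \<Rightarrow> real^'n" and H :: "'a \<Rightarrow> real^'l"
  assumes XH: "distributed M lborel (\<lambda>\<omega>. (X \<omega>, H \<omega>))
      (\<lambda>z. ennreal (case z of (u, v) \<Rightarrow> iso_gauss_density mu \<sigma> u * iso_gauss_density nu \<rho> v))"
    and \<sigma>: "0 < \<sigma>" and \<rho>: "0 < \<rho>"
  shows "distributed M lborel X (\<lambda>v. ennreal (iso_gauss_density mu \<sigma> v))"
    and "distributed M lborel H (\<lambda>v. ennreal (iso_gauss_density nu \<rho> v))"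
    and "A \<in> sets borel \<Longrightarrow> B \<in> sets borel \<Longrightarrow>
      prob {\<omega> \<in> space M. X \<omega> \<in> A \<and> H \<omega> \<in> B} = prob {\<omega> \<in> space M. X \<omega> \<in> A} * prob {\<omega> \<in> space M. H \<omega> \<in> B}"
proof -
  have XH': "distributed M (lborel \<Otimes>\<^sub>M lborel) (\<lambda>\<omega>. (X \<omega>, H \<omega>))
      (\<lambda>z. ennreal (case z of (u, v) \<Rightarrow> iso_gauss_density mu \<sigma> u * iso_gauss_density nu \<rho> v))"
    using XH by (simp add: lborel_prod)
  have sf: "sigma_finite_measure (lborel :: (real^'n) measure)" "sigma_finite_measure (lborel :: (real^'l) measure)" ..
  have f: "(\<integral>\<^sup>+z. ennreal (case (x, z) of (u, v) \<Rightarrow> iso_gauss_density mu \<sigma> u * iso_gauss_density nu \<rho> v) \<partial>lborel) = ennreal (iso_gauss_density mu \<sigma> x)" for x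
    by (simp add: ennreal_mult' iso_gauss_density_nonneg nn_integral_cmult nn_integral_iso_gauss_1[OF \<rho>])
  show X: "distributed M lborel X (\<lambda>v. ennreal (iso_gauss_density mu \<sigma> v))"
    using distr_marginal1[OF sf XH'] unfolding f .
  have g: "(\<integral>\<^sup>+z. ennreal (case (z, y) of (u, v) \<Rightarrow> iso_gauss_density mu \<sigma> u * iso_gauss_density nu \<rho> v) \<partial>lborel) = ennreal (iso_gauss_density nu \<rho> y)" for y
    by (simp add: ennreal_mult' iso_gauss_density_nonneg nn_integral_multc nn_integral_iso_gauss_1[OF \<sigma>])
  show H: "distributed M lborel H (\<lambda>v. ennreal (iso_gauss_density nu \<rho> v))"
    using distr_marginal2[OF sf XH'] unfolding g .
  have [measurable]: "X \<in> borel_measurable M" "H \<in> borel_measurable M"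
    using distributed_measurable[OF X] distributed_measurable[OF H] by simp_all
  assume [measurable]: "A \<in> sets borel" "B \<in> sets borel"
  have "emeasure M {\<omega> \<in> space M. X \<omega> \<in> A \<and> H \<omega> \<in> B} = emeasure M ((\<lambda>\<omega>. (X \<omega>, H \<omega>)) -` (A \<times> B) \<inter> space M)"
    by (rule arg_cong[of _ _ "emeasure M"]) auto
  also have "\<dots> = (\<integral>\<^sup>+z. ennreal (case z of (u, v) \<Rightarrow> iso_gauss_density mu \<sigma> u * iso_gauss_density nu \<rho> v) * indicator (A \<times> B) z \<partial>(lborel \<Otimes>\<^sub>M lborel))"
    by (rule distributed_emeasure[OF XH']) auto
  also have "\<dots> = (\<integral>\<^sup>+u. \<integral>\<^sup>+v. (ennreal (iso_gauss_density mu \<sigma> u) * indicator A u) * (ennreal (iso_gauss_density nu \<rho> v) * indicator B v) \<partial>lborel \<partial>lborel)"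
    by (subst lborel.nn_integral_fst[symmetric])
      (auto intro!: nn_integral_cong simp: indicator_times ennreal_mult' iso_gauss_density_nonneg mult_ac)
  also have "\<dots> = emeasure M (X -` A \<inter> space M) * emeasure M (H -` B \<inter> space M)"
    by (simp add: nn_integral_cmult nn_integral_multc distributed_emeasure[OF X] distributed_emeasure[OF H])
  also have "X -` A \<inter> space M = {\<omega> \<in> space M. X \<omega> \<in> A}" by auto
  also have "H -` B \<inter> space M = {\<omega> \<in> space M. H \<omega> \<in> B}" by auto
  finally show "prob {\<omega> \<in> space M. X \<omega> \<in> A \<and> H \<omega> \<in> B} = prob {\<omega> \<in> space M. X \<omega> \<in> A} * prob {\<omega> \<in> space M. H \<omega> \<in> B}"
    by (simp add: emeasure_eq_measure ennreal_mult'[symmetric])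
qed

text \<open>Conditioning on \<open>X\<close> without conditional expectations: the joint law is a
  product measure, so a bound valid on every section passes to the whole by Fubini.\<close>

lemma indep_var_section_bound:
  assumes ind: "indep_var S X T H" and B[measurable]: "B \<in> sets (S \<Otimes>\<^sub>M T)"
    and le: "\<And>x. x \<in> space S \<Longrightarrow> prob {\<omega> \<in> space M. (x, H \<omega>) \<in> B} \<le> \<beta>"
  shows "prob {\<omega> \<in> space M. (X \<omega>, H \<omega>) \<in> B} \<le> \<beta>"
proof -
  have [measurable]: "X \<in> measurable M S" "H \<in> measurable M T"
    using indep_var_rv1[OF ind] indep_var_rv2[OF ind] by auto
  interpret DX: prob_space "distr M S X" by (rule prob_space_distr) simp
  interpret DH: prob_space "distr M T H" by (rule prob_space_distr) simp
  have "0 \<le> \<beta>"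
  proof -
    obtain x where "x \<in> space S" using DX.not_empty by auto
    from le[OF this] show ?thesis by (rule order_trans[OF measure_nonneg])
  qed
  have "ennreal (prob {\<omega> \<in> space M. (X \<omega>, H \<omega>) \<in> B}) = emeasure (distr M (S \<Otimes>\<^sub>M T) (\<lambda>\<omega>. (X \<omega>, H \<omega>))) B"
    by (subst emeasure_distr) (auto simp: emeasure_eq_measure intro!: arg_cong[of _ _ prob])
  also have "\<dots> = emeasure (distr M S X \<Otimes>\<^sub>M distr M T H) B"
    using ind by (simp add: indep_var_distribution_eq)
  also have "\<dots> = (\<integral>\<^sup>+x. emeasure (distr M T H) (Pair x -` B) \<partial>distr M S X)"
    by (rule DH.emeasure_pair_measure_alt) (simp cong: sets_pair_measure_cong)
  also have "\<dots> \<le> (\<integral>\<^sup>+x. ennreal \<beta> \<partial>distr M S X)"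
  proof (rule nn_integral_mono)
    fix x assume "x \<in> space (distr M S X)"
    hence x: "x \<in> space S" by simp
    have "emeasure (distr M T H) (Pair x -` B) = emeasure M (H -` (Pair x -` B) \<inter> space M)"
      by (rule emeasure_distr) (auto intro: sets_Pair1)
    also have "H -` (Pair x -` B) \<inter> space M = {\<omega> \<in> space M. (x, H \<omega>) \<in> B}" by auto
    finally show "emeasure (distr M T H) (Pair x -` B) \<le> ennreal \<beta>"
      using le[OF x] by (simp add: emeasure_eq_measure ennreal_leI)
  qed
  also have "\<dots> = ennreal \<beta>" using DX.emeasure_space_1 by simp
  finally show ?thesis using \<open>0 \<le> \<beta>\<close> by simp
qed

text \<open>Independence across pairs and independence inside each pair combine to make all
  \<open>X k\<close> jointly independent of all \<open>H k\<close>. The third conclusion is then the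
  section bound for the two whole families.\<close>

lemma pair_families_independent:
  fixes X :: "'k \<Rightarrow> 'a \<Rightarrow> 'b::euclidean_space" and H :: "'k \<Rightarrow> 'a \<Rightarrow> 'c::euclidean_space"
  assumes ind: "indep_vars (\<lambda>_. borel) (\<lambda>k \<omega>. (X k \<omega>, H k \<omega>)) K"
    and K: "finite K" "K \<noteq> {}"
    and prod: "\<And>k A B. k \<in> K \<Longrightarrow> A \<in> sets borel \<Longrightarrow> B \<in> sets borel \<Longrightarrow>
      prob {\<omega> \<in> space M. X k \<omega> \<in> A \<and> H k \<omega> \<in> B} = prob {\<omega> \<in> space M. X k \<omega> \<in> A} * prob {\<omega> \<in> space M. H k \<omega> \<in> B}"
  shows "indep_vars (\<lambda>_. borel) X K" and "indep_vars (\<lambda>_. borel) H K"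
    and "B \<in> sets (PiM K (\<lambda>_. borel) \<Otimes>\<^sub>M PiM K (\<lambda>_. borel)) \<Longrightarrow>
      (\<And>x. x \<in> space (PiM K (\<lambda>_. borel)) \<Longrightarrow> prob {\<omega> \<in> space M. (x, \<lambda>k\<in>K. H k \<omega>) \<in> B} \<le> \<beta>) \<Longrightarrow>
      prob {\<omega> \<in> space M. (\<lambda>k\<in>K. X k \<omega>, \<lambda>k\<in>K. H k \<omega>) \<in> B} \<le> \<beta>"
proof -
  have mf[measurable]: "(fst :: 'b \<times> 'c \<Rightarrow> 'b) \<in> borel_measurable borel" "(snd :: 'b \<times> 'c \<Rightarrow> 'c) \<in> borel_measurable borel"
    by (auto intro!: borel_measurable_continuous_onI continuous_intros)
  show iX: "indep_vars (\<lambda>_. borel) X K"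
    using indep_vars_compose2[OF ind, of "\<lambda>_. fst" "\<lambda>_. borel"] by simp
  show iH: "indep_vars (\<lambda>_. borel) H K"
    using indep_vars_compose2[OF ind, of "\<lambda>_. snd" "\<lambda>_. borel"] by simp
  have m[measurable]: "X k \<in> borel_measurable M" "H k \<in> borel_measurable M" if "k \<in> K" for k
    using iX iH that by (auto simp: indep_vars_def)
  \<comment> \<open>padding with zeros gives both families the same codomain, as \<open>indep_vars\<close> requires\<close>
  define Y where "Y = (\<lambda>(k, b) \<omega>. if b then (X k \<omega>, 0) else (0, H k \<omega>))"
  have Ym: "Y i \<in> borel_measurable M" if "i \<in> K \<times> UNIV" for i
    using that by (cases i) (auto simp: Y_def)
  have iY: "indep_vars (\<lambda>_. borel) Y (K \<times> UNIV)"
  proof (subst indep_vars_finite[where E = "\<lambda>_. sets borel"])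
    show "\<forall>A\<in>K \<times> UNIV \<rightarrow> sets borel. prob (\<Inter>i\<in>K \<times> UNIV. Y i -` A i \<inter> space M) =
      (\<Prod>i\<in>K \<times> UNIV. prob (Y i -` A i \<inter> space M))"
    proof
      fix A :: "'k \<times> bool \<Rightarrow> ('b \<times> 'c) set" assume A: "A \<in> K \<times> UNIV \<rightarrow> sets borel"
      \<comment> \<open>Pulling test sets back along the padding turns an event about
        \<open>Y\<close> into one about the original pairs, where \<open>ind\<close> and
        \<open>prod\<close> apply.\<close>
      define A1 where "A1 k = (\<lambda>u. (u, 0)) -` A (k, True)" for k
      define A2 where "A2 k = (\<lambda>u. (0, u)) -` A (k, False)" for k
      have A1: "A1 k \<in> sets borel" if "k \<in> K" for k
        unfolding A1_def using A that by (intro measurable_sets_borel[where M = borel]) auto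
      have A2: "A2 k \<in> sets borel" if "k \<in> K" for k
        unfolding A2_def using A that by (intro measurable_sets_borel[where M = borel]) auto
      have "(\<Inter>i\<in>K \<times> UNIV. Y i -` A i \<inter> space M) = (\<Inter>k\<in>K. (\<lambda>\<omega>. (X k \<omega>, H k \<omega>)) -` (A1 k \<times> A2 k) \<inter> space M)"
        using K by (auto simp: Y_def A1_def A2_def UNIV_bool)
      also have "prob \<dots> = (\<Prod>k\<in>K. prob ((\<lambda>\<omega>. (X k \<omega>, H k \<omega>)) -` (A1 k \<times> A2 k) \<inter> space M))"
        using K A1 A2 by (intro indep_varsD[OF ind]) (auto simp: borel_prod[symmetric])
      also have "\<dots> = (\<Prod>k\<in>K. prob (Y (k, True) -` A (k, True) \<inter> space M) * prob (Y (k, False) -` A (k, False) \<inter> space M))"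
      proof (rule prod.cong[OF refl])
        fix k assume k: "k \<in> K"
        have "(\<lambda>\<omega>. (X k \<omega>, H k \<omega>)) -` (A1 k \<times> A2 k) \<inter> space M = {\<omega> \<in> space M. X k \<omega> \<in> A1 k \<and> H k \<omega> \<in> A2 k}" by auto
        moreover have "Y (k, True) -` A (k, True) \<inter> space M = {\<omega> \<in> space M. X k \<omega> \<in> A1 k}" by (auto simp: Y_def A1_def)
        moreover have "Y (k, False) -` A (k, False) \<inter> space M = {\<omega> \<in> space M. H k \<omega> \<in> A2 k}" by (auto simp: Y_def A2_def)
        ultimately show "prob ((\<lambda>\<omega>. (X k \<omega>, H k \<omega>)) -` (A1 k \<times> A2 k) \<inter> space M) =
          prob (Y (k, True) -` A (k, True) \<inter> space M) * prob (Y (k, False) -` A (k, False) \<inter> space M)"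
          using prod[OF k A1[OF k] A2[OF k]] by simp
      qed
      also have "\<dots> = (\<Prod>k\<in>K. \<Prod>b\<in>UNIV. prob (Y (k, b) -` A (k, b) \<inter> space M))"
        by (simp add: UNIV_bool mult.commute)
      also have "\<dots> = (\<Prod>i\<in>K \<times> UNIV. prob (Y i -` A i \<inter> space M))"
        by (subst prod.cartesian_product) (simp add: split_def)
      finally show "prob (\<Inter>i\<in>K \<times> UNIV. Y i -` A i \<inter> space M) = (\<Prod>i\<in>K \<times> UNIV. prob (Y i -` A i \<inter> space M))" .
    qed
  qed (use K Ym in \<open>auto simp: sets.sigma_sets_eq[of borel, simplified] Int_stable_def\<close>)
  \<comment> \<open>Grouping the index set by its boolean flag separates the whole design from the
    whole noise; \<open>PX\<close> and \<open>PH\<close> below strip the padding again.\<close>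
  have iR: "indep_var (PiM (K \<times> {True}) (\<lambda>_. borel)) (\<lambda>\<omega>. restrict (\<lambda>i. Y i \<omega>) (K \<times> {True}))
      (PiM (K \<times> {False}) (\<lambda>_. borel)) (\<lambda>\<omega>. restrict (\<lambda>i. Y i \<omega>) (K \<times> {False}))"
    by (rule indep_var_restrict[OF iY]) auto
  define PX where "PX = (\<lambda>f :: 'k \<times> bool \<Rightarrow> 'b \<times> 'c. \<lambda>k\<in>K. fst (f (k, True)))"
  define PH where "PH = (\<lambda>f :: 'k \<times> bool \<Rightarrow> 'b \<times> 'c. \<lambda>k\<in>K. snd (f (k, False)))"
  have [measurable]: "PX \<in> measurable (PiM (K \<times> {True}) (\<lambda>_. borel)) (PiM K (\<lambda>_. borel))"
    unfolding PX_def
    by (intro measurable_restrict measurable_compose[OF _ mf(1)] measurable_component_singleton[where M = "\<lambda>_. borel"]) auto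
  have [measurable]: "PH \<in> measurable (PiM (K \<times> {False}) (\<lambda>_. borel)) (PiM K (\<lambda>_. borel))"
    unfolding PH_def
    by (intro measurable_restrict measurable_compose[OF _ mf(2)] measurable_component_singleton[where M = "\<lambda>_. borel"]) auto
  have PX: "PX (restrict (\<lambda>i. Y i \<omega>) (K \<times> {True})) = (\<lambda>k\<in>K. X k \<omega>)" for \<omega>
    by (auto simp: fun_eq_iff PX_def Y_def restrict_def)
  have PH: "PH (restrict (\<lambda>i. Y i \<omega>) (K \<times> {False})) = (\<lambda>k\<in>K. H k \<omega>)" for \<omega>
    by (auto simp: fun_eq_iff PH_def Y_def restrict_def)
  assume B[measurable]: "B \<in> sets (PiM K (\<lambda>_. borel) \<Otimes>\<^sub>M PiM K (\<lambda>_. borel))"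
    and le: "\<And>x. x \<in> space (PiM K (\<lambda>_. borel)) \<Longrightarrow> prob {\<omega> \<in> space M. (x, \<lambda>k\<in>K. H k \<omega>) \<in> B} \<le> \<beta>"
  let ?S = "PiM (K \<times> {True}) (\<lambda>_. borel :: ('b \<times> 'c) measure)"
  let ?T = "PiM (K \<times> {False}) (\<lambda>_. borel :: ('b \<times> 'c) measure)"
  define B0 where "B0 = {z \<in> space (?S \<Otimes>\<^sub>M ?T). (PX (fst z), PH (snd z)) \<in> B}"
  have B0: "B0 \<in> sets (?S \<Otimes>\<^sub>M ?T)" unfolding B0_def by measurable
  have R: "restrict (\<lambda>i. Y i \<omega>) (K \<times> {b}) \<in> space (PiM (K \<times> {b}) (\<lambda>_. borel))" for b \<omega>
    by (simp add: space_PiM)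
  have "prob {\<omega> \<in> space M. (restrict (\<lambda>i. Y i \<omega>) (K \<times> {True}), restrict (\<lambda>i. Y i \<omega>) (K \<times> {False})) \<in> B0} \<le> \<beta>"
  proof (rule indep_var_section_bound[OF iR B0])
    fix x assume x: "x \<in> space ?S"
    have "{\<omega> \<in> space M. (x, restrict (\<lambda>i. Y i \<omega>) (K \<times> {False})) \<in> B0} = {\<omega> \<in> space M. (PX x, \<lambda>k\<in>K. H k \<omega>) \<in> B}"
      using x R[of _ False] by (auto simp: B0_def PH space_pair_measure)
    thus "prob {\<omega> \<in> space M. (x, restrict (\<lambda>i. Y i \<omega>) (K \<times> {False})) \<in> B0} \<le> \<beta>"
      using le[of "PX x"] x by (simp add: PX_def space_PiM)
  qed
  also have "{\<omega> \<in> space M. (restrict (\<lambda>i. Y i \<omega>) (K \<times> {True}), restrict (\<lambda>i. Y i \<omega>) (K \<times> {False})) \<in> B0} =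
      {\<omega> \<in> space M. (\<lambda>k\<in>K. X k \<omega>, \<lambda>k\<in>K. H k \<omega>) \<in> B}"
    using R[of _ False] R[of _ True] by (auto simp: B0_def PX PH space_pair_measure)
  finally show "prob {\<omega> \<in> space M. (\<lambda>k\<in>K. X k \<omega>, \<lambda>k\<in>K. H k \<omega>) \<in> B} \<le> \<beta>" .
qed

end

section \<open>Uniform tail bounds for random quadratic forms\<close>

text \<open>The expression is the Euclidean norm of the vector formed by sqrt c |v| and the numbers
  a k \<bullet> v, so the triangle inequality is Minkowski's. The design uses \<open>c = 1\<close>,
  the noise \<open>c = 0\<close>.\<close>

lemma vector_norm_quadratic:
  fixes a :: "'k \<Rightarrow> 'b::euclidean_space"
  assumes c: "0 \<le> c" and \<alpha>: "0 < \<alpha>"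
    and lower: "\<And>v. \<alpha>\<^sup>2 * (norm v)\<^sup>2 \<le> c * (norm v)\<^sup>2 + (\<Sum>k\<in>K. (a k \<bullet> v)\<^sup>2)"
  shows "vector_norm (\<lambda>v. sqrt (c * (norm v)\<^sup>2 + (\<Sum>k\<in>K. (a k \<bullet> v)\<^sup>2))) \<alpha>"
proof
  fix v w :: 'b and r :: real
  have eq: "sqrt (c * (norm v)\<^sup>2 + (\<Sum>k\<in>K. (a k \<bullet> v)\<^sup>2)) = sqrt ((sqrt c * norm v)\<^sup>2 + (L2_set (\<lambda>k. a k \<bullet> v) K)\<^sup>2)" for v
    using c by (simp add: power_mult_distrib L2_set_def sum_nonneg)
  have "sqrt ((sqrt c * norm (v + w))\<^sup>2 + (L2_set (\<lambda>k. a k \<bullet> (v + w)) K)\<^sup>2) \<le>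
    sqrt ((sqrt c * norm v + sqrt c * norm w)\<^sup>2 + (L2_set (\<lambda>k. a k \<bullet> v) K + L2_set (\<lambda>k. a k \<bullet> w) K)\<^sup>2)"
  proof (intro real_sqrt_le_mono add_mono power_mono)
    show "sqrt c * norm (v + w) \<le> sqrt c * norm v + sqrt c * norm w"
      using c by (simp add: distrib_left[symmetric] mult_left_mono norm_triangle_ineq)
    show "L2_set (\<lambda>k. a k \<bullet> (v + w)) K \<le> L2_set (\<lambda>k. a k \<bullet> v) K + L2_set (\<lambda>k. a k \<bullet> w) K"
      by (simp add: inner_add_right L2_set_triangle_ineq)
  qed (use c in auto)
  also have "\<dots> \<le> sqrt ((sqrt c * norm v)\<^sup>2 + (L2_set (\<lambda>k. a k \<bullet> v) K)\<^sup>2) + sqrt ((sqrt c * norm w)\<^sup>2 + (L2_set (\<lambda>k. a k \<bullet> w) K)\<^sup>2)"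
    by (rule real_sqrt_sum_squares_triangle_ineq)
  finally show "sqrt (c * (norm (v + w))\<^sup>2 + (\<Sum>k\<in>K. (a k \<bullet> (v + w))\<^sup>2)) \<le>
    sqrt (c * (norm v)\<^sup>2 + (\<Sum>k\<in>K. (a k \<bullet> v)\<^sup>2)) + sqrt (c * (norm w)\<^sup>2 + (\<Sum>k\<in>K. (a k \<bullet> w)\<^sup>2))"
    unfolding eq .
  have "c * (norm (r *\<^sub>R v))\<^sup>2 + (\<Sum>k\<in>K. (a k \<bullet> (r *\<^sub>R v))\<^sup>2) = r\<^sup>2 * (c * (norm v)\<^sup>2 + (\<Sum>k\<in>K. (a k \<bullet> v)\<^sup>2))"
    by (simp add: power_mult_distrib sum_distrib_left algebra_simps)
  thus "sqrt (c * (norm (r *\<^sub>R v))\<^sup>2 + (\<Sum>k\<in>K. (a k \<bullet> (r *\<^sub>R v))\<^sup>2)) = \<bar>r\<bar> * sqrt (c * (norm v)\<^sup>2 + (\<Sum>k\<in>K. (a k \<bullet> v)\<^sup>2))"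
    by (simp add: real_sqrt_mult)
  show "0 < \<alpha>" by fact
  show "\<alpha> * norm v \<le> sqrt (c * (norm v)\<^sup>2 + (\<Sum>k\<in>K. (a k \<bullet> v)\<^sup>2))"
    using lower[of v] by (intro real_le_rsqrt) (simp add: power_mult_distrib)
  show "continuous_on UNIV (\<lambda>v. sqrt (c * (norm v)\<^sup>2 + (\<Sum>k\<in>K. (a k \<bullet> v)\<^sup>2)))"
    by (intro continuous_intros)
qed

context vector_norm
begin

lemma scale_from_unit:
  assumes Q: "\<And>r v. Q (r *\<^sub>R v) = r\<^sup>2 * Q v" and 1: "\<And>v. p v = 1 \<Longrightarrow> Q v \<le> R"
  shows "Q v \<le> R * (p v)\<^sup>2"
proof (cases "v = 0")
  case True
  thus ?thesis using Q[of 0 0] zero by simp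
next
  case False
  hence pos: "0 < p v" using lower[of v] alpha_pos by (intro order.strict_trans2[OF _ lower]) simp
  have "p ((1 / p v) *\<^sub>R v) = 1" using pos by (simp add: scale)
  hence "(1 / p v)\<^sup>2 * Q v \<le> R" using 1[of "(1 / p v) *\<^sub>R v"] Q[of "1 / p v" v] by simp
  thus ?thesis using pos by (simp add: power_divide field_simps)
qed

lemma quadratic_upper_tail:
  fixes Q :: "'a \<Rightarrow> 'b \<Rightarrow> real"
  assumes M: "prob_space M" and e: "0 < e" and \<theta>: "0 < \<theta>" and b: "0 \<le> b"
    and meas[measurable]: "(\<lambda>(\<omega>, w). Q \<omega> w) \<in> borel_measurable (M \<Otimes>\<^sub>M borel)"
    and par: "\<And>\<omega> v z. Q \<omega> (v + z) + Q \<omega> (v - z) = 2 * Q \<omega> v + 2 * Q \<omega> z"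
    and hom: "\<And>\<omega> r v. Q \<omega> (r *\<^sub>R v) = r\<^sup>2 * Q \<omega> v"
    and nonneg_Q: "\<And>\<omega> v. 0 \<le> Q \<omega> v"
    and bound: "\<And>w. p w \<le> 1 + e \<Longrightarrow> (\<integral>\<^sup>+\<omega>. ennreal (exp (\<theta> * Q \<omega> w)) \<partial>M) \<le> ennreal b"
  shows "\<exists>G\<in>sets M. measure M (space M - G) \<le> ((1 + e) / e) ^ DIM('b) * b / exp (\<theta> * R) \<and>
    (\<forall>\<omega>\<in>G. \<forall>v. Q \<omega> v \<le> R * (p v)\<^sup>2)"
proof -
  obtain G where G: "G \<in> sets M" "measure M (space M - G) \<le> ((1 + e) / e) ^ DIM('b) * b / exp (\<theta> * R)"
    and *: "\<And>\<omega> v. \<omega> \<in> G \<Longrightarrow> p v = 1 \<Longrightarrow>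
      \<exists>z. p z \<le> e \<and> exp (\<theta> * Q \<omega> (v + z)) * exp (\<theta> * Q \<omega> (v - z)) < (exp (\<theta> * R))\<^sup>2"
    using ball_union_bound[OF M e, of "exp (\<theta> * R)" b "\<lambda>\<omega> w. exp (\<theta> * Q \<omega> w)"] b bound by auto
  have "Q \<omega> v \<le> R" if h: "\<omega> \<in> G" "p v = 1" for \<omega> v
  proof -
    obtain z where z: "exp (\<theta> * Q \<omega> (v + z)) * exp (\<theta> * Q \<omega> (v - z)) < (exp (\<theta> * R))\<^sup>2"
      using *[OF h] by auto
    have "\<theta> * (Q \<omega> (v + z) + Q \<omega> (v - z)) < \<theta> * (2 * R)"
      using z by (simp add: exp_add[symmetric] power2_eq_square algebra_simps)
    hence "2 * Q \<omega> v + 2 * Q \<omega> z < 2 * R" using \<theta> par[of \<omega> v z] by simp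
    thus ?thesis using nonneg_Q[of \<omega> z] by linarith
  qed
  thus ?thesis using G scale_from_unit[of "Q _" R, OF hom] by blast
qed

text \<open>Now the pairing bounds Q v + Q z from below and Q z has to be subtracted. An upper bound
  with constant \<open>R\<close> on all of \<open>Q\<close> makes this loss at most e^2 R, which a
  small \<open>e\<close> renders harmless even for a crude \<open>R\<close>.\<close>

lemma quadratic_lower_tail:
  fixes Q :: "'a \<Rightarrow> 'b \<Rightarrow> real"
  assumes M: "prob_space M" and e: "0 < e" and \<theta>: "0 < \<theta>" and b: "0 \<le> b"
    and meas[measurable]: "(\<lambda>(\<omega>, w). Q \<omega> w) \<in> borel_measurable (M \<Otimes>\<^sub>M borel)"
    and par: "\<And>\<omega> v z. Q \<omega> (v + z) + Q \<omega> (v - z) = 2 * Q \<omega> v + 2 * Q \<omega> z"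
    and hom: "\<And>\<omega> r v. Q \<omega> (r *\<^sub>R v) = r\<^sup>2 * Q \<omega> v"
    and bound: "\<And>w. 1 - e \<le> p w \<Longrightarrow> (\<integral>\<^sup>+\<omega>. ennreal (exp (- \<theta> * Q \<omega> w)) \<partial>M) \<le> ennreal b"
    and R: "0 \<le> R"
  shows "\<exists>G\<in>sets M. measure M (space M - G) \<le> ((1 + e) / e) ^ DIM('b) * b / exp (- \<theta> * (r + e\<^sup>2 * R)) \<and>
    (\<forall>\<omega>\<in>G. (\<forall>v. Q \<omega> v \<le> R * (p v)\<^sup>2) \<longrightarrow> (\<forall>v. r * (p v)\<^sup>2 \<le> Q \<omega> v))"
proof -
  obtain G where G: "G \<in> sets M" "measure M (space M - G) \<le> ((1 + e) / e) ^ DIM('b) * b / exp (- \<theta> * (r + e\<^sup>2 * R))"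
    and *: "\<And>\<omega> v. \<omega> \<in> G \<Longrightarrow> p v = 1 \<Longrightarrow>
      \<exists>z. p z \<le> e \<and> exp (- \<theta> * Q \<omega> (v + z)) * exp (- \<theta> * Q \<omega> (v - z)) < (exp (- \<theta> * (r + e\<^sup>2 * R)))\<^sup>2"
    using ball_union_bound[OF M e, of "exp (- \<theta> * (r + e\<^sup>2 * R))" b "\<lambda>\<omega> w. exp (- \<theta> * Q \<omega> w)"] b bound by auto
  \<comment> \<open>Stated for the negated form so that \<open>scale_from_unit\<close>, which
    extends upper bounds from the unit sphere, applies.\<close>
  have "- Q \<omega> v \<le> - r" if h: "\<omega> \<in> G" "p v = 1" and up: "\<And>v. Q \<omega> v \<le> R * (p v)\<^sup>2" for \<omega> v
  proof -
    obtain z where z: "p z \<le> e" "exp (- \<theta> * Q \<omega> (v + z)) * exp (- \<theta> * Q \<omega> (v - z)) < (exp (- \<theta> * (r + e\<^sup>2 * R)))\<^sup>2"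
      using *[OF h] by auto
    have "\<theta> * (2 * (r + e\<^sup>2 * R)) < \<theta> * (Q \<omega> (v + z) + Q \<omega> (v - z))"
      using z(2) by (simp add: exp_add[symmetric] power2_eq_square algebra_simps)
    hence 1: "2 * (r + e\<^sup>2 * R) < 2 * Q \<omega> v + 2 * Q \<omega> z" using \<theta> par[of \<omega> v z] by simp
    have "Q \<omega> z \<le> R * (p z)\<^sup>2" by (rule up)
    also have "\<dots> \<le> R * e\<^sup>2" using z(1) R nonneg by (intro mult_left_mono power_mono) auto
    finally show ?thesis using 1 by (simp add: algebra_simps)
  qed
  hence "- Q \<omega> v \<le> (- r) * (p v)\<^sup>2" if "\<omega> \<in> G" "\<And>v. Q \<omega> v \<le> R * (p v)\<^sup>2" for \<omega> v
    using that by (intro scale_from_unit[of "\<lambda>v. - Q \<omega> v"]) (auto simp: hom)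
  thus ?thesis using G by (intro bexI[of _ G]) force+
qed

end

section \<open>Design matrix and noise\<close>

text \<open>The arguments 5, 17 and 11 are the volume ratios (1 + e) / e for e = 1/4, 1/16 and 1/10;
  200/79 and 1831/512 come from the one-sample moments. Splitting off a power of 2 brings an
  argument close to 1, where ln c <= c - 1 is accurate.\<close>

lemma ln_numeral_bounds:
  "ln 5 \<le> (59/36 :: real)" "ln 17 \<le> (409/144 :: real)" "ln 11 \<le> (5/2 :: real)"
  "ln (200/79) \<le> (1 :: real)" "6/5 \<le> ln (1831/512 :: real)" "ln 2 \<le> (25/36 :: real)"
proof -
  have l2: "ln 2 \<le> (25/36 :: real)" by (rule ln2_le_25_over_36)
  have g2: "2/3 \<le> ln (2::real)" by (rule ln2_ge_two_thirds)
  have eq: "ln (c * 2 ^ k) = ln c + real k * ln 2" if "0 < c" for c :: real and k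
    using that by (simp add: ln_mult ln_realpow)
  have d: "ln (c * 2 ^ k) \<le> c - 1 + real k * ln 2" if "0 < c" for c :: real and k
    using eq[OF that] ln_le_minus_one[OF that] by simp
  show "ln 5 \<le> (59/36 :: real)" using d[of "5/4" 2] l2 by simp
  show "ln 17 \<le> (409/144 :: real)" using d[of "17/16" 4] l2 by simp
  show "ln 11 \<le> (5/2 :: real)" using d[of "11/8" 3] l2 by simp
  show "ln (200/79) \<le> (1 :: real)" using d[of "100/79" 1] l2 by simp
  have "ln (512/1831) \<le> (- 6/5 :: real)"
  proof -
    have "ln (512/1831 :: real) + 2 * ln 2 = ln (2048/1831)"
      using eq[of "512/1831" 2] by simp
    moreover have "ln (2048/1831 :: real) \<le> 2048/1831 - 1" by (rule ln_le_minus_one) simp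
    ultimately show ?thesis using g2 by simp
  qed
  moreover have "ln (512/1831 :: real) = - ln (1831/512)" by (subst ln_inverse[symmetric]) auto
  ultimately show "6/5 \<le> ln (1831/512 :: real)" by simp
  show "ln 2 \<le> (25/36 :: real)" by fact
qed

lemma power_eq_exp_ln: "0 < (x::real) \<Longrightarrow> x ^ n = exp (real n * ln x)"
  by (simp add: exp_of_nat_mult)

text \<open>The next two lemmas optimise the one-sample exponential moment at a point with \<open>p w\<close> fixed over the possible
  values of \<open>\<bar>w\<bar>\<close>; there \<open>Y = 1 - \<kappa> (p w)\<^sup>2\<close> and \<open>D = 1 - \<kappa> \<bar>w\<bar>\<^sup>2\<close>, with
  \<open>\<kappa>\<close> positive in the first and negative in the second.\<close>
lemma upper_factor:
  fixes Y D :: real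
  assumes "0 < Y" "Y \<le> D"
  shows "1 / sqrt D * exp ((D - Y) / (4 * D)) \<le> 1 / sqrt Y"
proof -
  have D: "0 < D" using assms by simp
  \<comment> \<open>The determinant offers (ln D - ln Y) / 2, which is at least half of (D - Y) / D,
    while the means consume only a quarter of it.\<close>
  have "ln (Y / D) \<le> Y / D - 1" using assms by (intro ln_le_minus_one) simp
  hence "ln Y - ln D \<le> - ((D - Y) / D)" using assms D by (simp add: ln_div diff_divide_distrib)
  moreover have "0 \<le> (D - Y) / D" using assms D by simp
  moreover have "(D - Y) / (4 * D) = (D - Y) / D / 4" by simp
  ultimately have "(D - Y) / (4 * D) + ln Y / 2 \<le> ln D / 2" by linarith
  hence "(D - Y) / (4 * D) + ln (sqrt Y) \<le> ln (sqrt D)"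
    using assms D by (simp add: ln_sqrt)
  hence "exp ((D - Y) / (4 * D)) * sqrt Y \<le> sqrt D"
    using assms D by (metis exp_add exp_le_cancel_iff exp_ln real_sqrt_gt_zero)
  thus ?thesis using assms D by (simp add: divide_simps mult.commute)
qed

lemma lower_factor:
  fixes Y D :: real
  assumes "0 < D" "0 < Y"
  shows "1 / sqrt D * exp (- ((Y - D) / (4 * D))) \<le> sqrt (2 / Y) * exp (- 1/4)"
proof -
  \<comment> \<open>For fixed \<open>Y\<close> the left side is largest at D = Y / 2. There q = 1
    and ln q <= q - 1 is an equality, so the bound is sharp.\<close>
  define q where "q = Y / (2 * D)"
  have "ln q \<le> q - 1" unfolding q_def using assms by (intro ln_le_minus_one) simp
  moreover have "ln q = ln Y - ln 2 - ln D" using assms by (simp add: q_def ln_div ln_mult)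
  moreover have "(Y - D) / (4 * D) = q / 2 - 1 / 4" using assms by (simp add: q_def field_simps)
  ultimately have "- ((Y - D) / (4 * D)) + - ln D / 2 \<le> (ln 2 - ln Y) / 2 + - 1/4" by simp
  hence "- ((Y - D) / (4 * D)) + ln (1 / sqrt D) \<le> ln (sqrt (2 / Y)) + - 1/4"
    using assms by (simp add: ln_sqrt ln_div)
  hence "exp (- ((Y - D) / (4 * D)) + ln (1 / sqrt D)) \<le> exp (ln (sqrt (2 / Y)) + - 1/4)"
    by (simp only: exp_le_cancel_iff)
  hence "exp (- ((Y - D) / (4 * D))) * (1 / sqrt D) \<le> sqrt (2 / Y) * exp (- 1/4)"
    using assms unfolding exp_add by (subst (asm) (1 2) exp_ln) auto
  thus ?thesis by (simp only: mult.commute)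
qed

context prob_space
begin

lemma iso_gauss_design_lower_bound:
  fixes X :: "'k \<Rightarrow> 'a \<Rightarrow> real^'n"
  assumes X: "\<And>k. k \<in> K \<Longrightarrow> distributed M lborel (X k) (\<lambda>v. ennreal (iso_gauss_density (mu k) \<sigma> v))"
    and ind: "indep_vars (\<lambda>_. borel) X K" and K: "finite K" and \<sigma>: "0 < \<sigma>"
    and L: "0 \<le> L" and large: "8 * real CARD('n) + 16 * L \<le> real (card K)"
  shows "\<exists>G\<in>events. prob (space M - G) \<le> 2 * exp (- L) \<and>
    (\<forall>\<omega>\<in>G. \<forall>v. real (card K) * \<sigma>\<^sup>2 / 8 * ((norm v)\<^sup>2 + 2 / (real (card K) * \<sigma>\<^sup>2) * (\<Sum>k\<in>K. (mu k \<bullet> v)\<^sup>2))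
      \<le> (\<Sum>k\<in>K. (X k \<omega> \<bullet> v)\<^sup>2))"
proof -
  define N where "N = real (card K)"
  have n1: "1 \<le> real CARD('n)" by (simp add: Suc_leI)
  have N: "0 < N" "8 * real CARD('n) + 16 * L \<le> N" using large L n1 unfolding N_def by linarith+
  \<comment> \<open>With this scaling the mean of the form \<open>Q\<close> below at
    \<open>v\<close> is N \<sigma>^2 (p v^2 + |v|^2) / 2, which lies between half of N \<sigma>^2 p
    v^2 and all of it.\<close>
  define a where "a k = sqrt (2 / (N * \<sigma>\<^sup>2)) *\<^sub>R mu k" for k
  have a2: "(\<Sum>k\<in>K. (a k \<bullet> v)\<^sup>2) = 2 / (N * \<sigma>\<^sup>2) * (\<Sum>k\<in>K. (mu k \<bullet> v)\<^sup>2)" for v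
    using N \<sigma> by (simp add: a_def power_mult_distrib sum_distrib_left)
  define p where "p v = sqrt (1 * (norm v)\<^sup>2 + (\<Sum>k\<in>K. (a k \<bullet> v)\<^sup>2))" for v
  interpret vector_norm p 1
    unfolding p_def by (rule vector_norm_quadratic) (auto intro: sum_nonneg)
  have p2: "(p v)\<^sup>2 = (norm v)\<^sup>2 + 2 / (N * \<sigma>\<^sup>2) * (\<Sum>k\<in>K. (mu k \<bullet> v)\<^sup>2)" for v
    unfolding p_def a2[symmetric] by (simp add: sum_nonneg)
  have mu2: "(\<Sum>k\<in>K. (mu k \<bullet> v)\<^sup>2) = ((p v)\<^sup>2 - (norm v)\<^sup>2) * (N * \<sigma>\<^sup>2) / 2" for v
    using N \<sigma> by (simp add: p2)
  have np: "(norm v)\<^sup>2 \<le> (p v)\<^sup>2" for v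
    using N \<sigma> by (simp add: p2 sum_nonneg)
  define Q where "Q \<omega> v = (\<Sum>k\<in>K. (X k \<omega> \<bullet> v)\<^sup>2)" for \<omega> v
  have [measurable]: "X k \<in> borel_measurable M" if "k \<in> K" for k
    using ind that by (auto simp: indep_vars_def)
  have meas: "(\<lambda>(\<omega>, w). Q \<omega> w) \<in> borel_measurable (M \<Otimes>\<^sub>M borel)"
    unfolding Q_def by measurable
  have par: "Q \<omega> (v + z) + Q \<omega> (v - z) = 2 * Q \<omega> v + 2 * Q \<omega> z" for \<omega> v z
    unfolding Q_def sum.distrib[symmetric] sum_distrib_left
    by (rule sum.cong) (auto simp: inner_add_right inner_diff_right power2_eq_square algebra_simps)
  have hom: "Q \<omega> (r *\<^sub>R v) = r\<^sup>2 * Q \<omega> v" for \<omega> r v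
    by (simp add: Q_def power_mult_distrib sum_distrib_left)
  have Q0: "0 \<le> Q \<omega> v" for \<omega> v by (simp add: Q_def sum_nonneg)
  \<comment> \<open>By \<open>mu2\<close> the means enter only through \<open>p w\<close>, and the
    factor \<open>N\<close> there makes the moment an exact \<open>card K\<close>-th power. Its base
    is what \<open>upper_factor\<close> and \<open>lower_factor\<close> estimate.\<close>
  have mgf: "(\<integral>\<^sup>+\<omega>. ennreal (exp (\<kappa> / (2 * \<sigma>\<^sup>2) * Q \<omega> w)) \<partial>M) =
    ennreal ((1 / sqrt (1 - \<kappa> * (norm w)\<^sup>2) * exp (\<kappa> * ((p w)\<^sup>2 - (norm w)\<^sup>2) / (4 * (1 - \<kappa> * (norm w)\<^sup>2)))) ^ card K)"
    if D: "0 < 1 - \<kappa> * (norm w)\<^sup>2" for \<kappa> w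
  proof -
    have eq: "2 * (\<kappa> / (2 * \<sigma>\<^sup>2)) * (\<sigma> * norm w)\<^sup>2 = \<kappa> * (norm w)\<^sup>2"
      using \<sigma> by (simp add: power_mult_distrib)
    have "\<kappa> / (2 * \<sigma>\<^sup>2) * (\<Sum>k\<in>K. (mu k \<bullet> w)\<^sup>2) / (1 - \<kappa> * (norm w)\<^sup>2)
       = real (card K) * (\<kappa> * ((p w)\<^sup>2 - (norm w)\<^sup>2) / (4 * (1 - \<kappa> * (norm w)\<^sup>2)))"
      using \<sigma> D unfolding mu2 N_def by (simp add: field_simps)
    hence F: "\<kappa> / (2 * \<sigma>\<^sup>2) * (\<Sum>k\<in>K. (mu k \<bullet> w)\<^sup>2) / (1 - \<kappa> * (norm w)\<^sup>2)
       = real (card K) * (\<kappa> * ((p w)\<^sup>2 - (norm w)\<^sup>2) / (4 * (1 - \<kappa> * (norm w)\<^sup>2)))" .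
    show ?thesis
      unfolding Q_def
      using iso_gauss_family_exp_square[OF X ind K \<sigma>, of "\<kappa> / (2 * \<sigma>\<^sup>2)" w, unfolded eq, OF _ D]
      unfolding F by (simp only: power_mult_distrib exp_of_nat_mult)
  qed
  \<comment> \<open>The crude upper bound. On the shell p w <= 5/4, and \<kappa> = 8/25 makes
    \<kappa> (p w)^2 <= 1/2, so one sample contributes at most sqrt 2. The constant 4 yields the
    decay 16/25 per sample, against ln 2 / 2.\<close>
  have "\<exists>G\<in>events. prob (space M - G) \<le> ((1 + 1/4) / (1/4)) ^ DIM(real^'n) * sqrt 2 ^ card K / exp ((8/25) / (2 * \<sigma>\<^sup>2) * (4 * N * \<sigma>\<^sup>2)) \<and>
    (\<forall>\<omega>\<in>G. \<forall>v. Q \<omega> v \<le> 4 * N * \<sigma>\<^sup>2 * (p v)\<^sup>2)"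
  proof (rule quadratic_upper_tail[OF prob_space_axioms _ _ _ meas par hom Q0])
    fix w assume "p w \<le> 1 + 1/4"
    hence "(p w)\<^sup>2 \<le> (5/4)\<^sup>2" using nonneg[of w] by (intro power_mono) auto
    hence Y: "1/2 \<le> 1 - 8/25 * (p w)\<^sup>2" by (simp add: power2_eq_square)
    have YD: "1 - 8/25 * (p w)\<^sup>2 \<le> 1 - 8/25 * (norm w)\<^sup>2" using np[of w] by simp
    have "1 / sqrt (1 - 8/25 * (norm w)\<^sup>2) * exp (8/25 * ((p w)\<^sup>2 - (norm w)\<^sup>2) / (4 * (1 - 8/25 * (norm w)\<^sup>2)))
      \<le> 1 / sqrt (1 - 8/25 * (p w)\<^sup>2)"
      using upper_factor[OF _ YD] Y by (simp add: right_diff_distrib)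
    also have "\<dots> \<le> 1 / sqrt (1/2)" using Y by (intro divide_left_mono mult_pos_pos real_sqrt_le_mono) auto
    also have "\<dots> = sqrt 2" by (simp add: real_sqrt_divide)
    finally show "(\<integral>\<^sup>+\<omega>. ennreal (exp ((8/25) / (2 * \<sigma>\<^sup>2) * Q \<omega> w)) \<partial>M) \<le> ennreal (sqrt 2 ^ card K)"
      using Y YD by (subst mgf) (auto intro!: ennreal_leI power_mono)
  qed (use \<sigma> in auto)
  then obtain G1 where G1: "G1 \<in> events" "\<And>\<omega> v. \<omega> \<in> G1 \<Longrightarrow> Q \<omega> v \<le> 4 * N * \<sigma>\<^sup>2 * (p v)\<^sup>2"
    and G1p: "prob (space M - G1) \<le> ((1 + 1/4) / (1/4)) ^ DIM(real^'n) * sqrt 2 ^ card K / exp ((8/25) / (2 * \<sigma>\<^sup>2) * (4 * N * \<sigma>\<^sup>2))"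
    by blast
  note G1p
  also have "((1 + 1/4) / (1/4)) ^ DIM(real^'n) * sqrt 2 ^ card K / exp ((8/25) / (2 * \<sigma>\<^sup>2) * (4 * N * \<sigma>\<^sup>2)) =
      exp (real CARD('n) * ln 5 + N * (ln 2 / 2) - 16/25 * N)"
    using \<sigma> by (simp add: power_eq_exp_ln exp_add exp_diff N_def ln_sqrt)
  also have "\<dots> \<le> exp (- L)"
  proof -
    have "real CARD('n) * ln 5 \<le> real CARD('n) * (59/36)" by (intro mult_left_mono ln_numeral_bounds) simp
    moreover have "N * (ln 2 / 2) \<le> N * (25/72)" using N ln_numeral_bounds(6) by (intro mult_left_mono) auto
    ultimately show ?thesis unfolding exp_le_cancel_iff using N n1 L by linarith
  qed
  finally have P1: "prob (space M - G1) \<le> exp (- L)" .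
  \<comment> \<open>The lower tail, with \<kappa> = -7. On the shell p w >= 15/16, hence 1 + 7 (p
    w)^2 >= 1831/256. The subtracted term e^2 R is N \<sigma>^2 / 64, small against the target N
    \<sigma>^2 / 8.\<close>
  have "\<exists>G\<in>events. prob (space M - G) \<le> ((1 + 1/16) / (1/16)) ^ DIM(real^'n) * (sqrt (512/1831) * exp (- 1/4)) ^ card K
        / exp (- (7 / (2 * \<sigma>\<^sup>2)) * (N * \<sigma>\<^sup>2 / 8 + (1/16)\<^sup>2 * (4 * N * \<sigma>\<^sup>2))) \<and>
    (\<forall>\<omega>\<in>G. (\<forall>v. Q \<omega> v \<le> 4 * N * \<sigma>\<^sup>2 * (p v)\<^sup>2) \<longrightarrow> (\<forall>v. N * \<sigma>\<^sup>2 / 8 * (p v)\<^sup>2 \<le> Q \<omega> v))"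
  proof (rule quadratic_lower_tail[OF prob_space_axioms _ _ _ meas par hom])
    fix w assume "1 - 1/16 \<le> p w"
    hence "(15/16)\<^sup>2 \<le> (p w)\<^sup>2" by (intro power_mono) auto
    hence Y: "1831/256 \<le> 1 + 7 * (p w)\<^sup>2" by (simp add: power2_eq_square)
    have D: "0 < 1 + 7 * (norm w)\<^sup>2" by (simp add: add_pos_nonneg)
    have "1 / sqrt (1 + 7 * (norm w)\<^sup>2) * exp (- 7 * ((p w)\<^sup>2 - (norm w)\<^sup>2) / (4 * (1 + 7 * (norm w)\<^sup>2)))
      \<le> sqrt (2 / (1 + 7 * (p w)\<^sup>2)) * exp (- 1/4)"
    proof -
      have "- 7 * ((p w)\<^sup>2 - (norm w)\<^sup>2) / (4 * (1 + 7 * (norm w)\<^sup>2)) =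
        - ((1 + 7 * (p w)\<^sup>2 - (1 + 7 * (norm w)\<^sup>2)) / (4 * (1 + 7 * (norm w)\<^sup>2)))"
        unfolding minus_divide_left by (rule arg_cong2[of _ _ _ _ "(/)"]) (simp_all add: algebra_simps)
      thus ?thesis using lower_factor[OF D, of "1 + 7 * (p w)\<^sup>2"] Y by (simp only:)
    qed
    also have "\<dots> \<le> sqrt (512/1831) * exp (- 1/4)"
      using Y by (intro mult_right_mono real_sqrt_le_mono) (auto simp: field_simps)
    finally show "(\<integral>\<^sup>+\<omega>. ennreal (exp (- (7 / (2 * \<sigma>\<^sup>2)) * Q \<omega> w)) \<partial>M) \<le> ennreal ((sqrt (512/1831) * exp (- 1/4)) ^ card K)"
      using D mgf[of "-7" w] by (auto intro!: ennreal_leI power_mono)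
  qed (use \<sigma> N in auto)
  then obtain G2 where G2: "G2 \<in> events" "\<And>\<omega> v. \<omega> \<in> G2 \<Longrightarrow> (\<And>v. Q \<omega> v \<le> 4 * N * \<sigma>\<^sup>2 * (p v)\<^sup>2) \<Longrightarrow> N * \<sigma>\<^sup>2 / 8 * (p v)\<^sup>2 \<le> Q \<omega> v"
    and G2p: "prob (space M - G2) \<le> ((1 + 1/16) / (1/16)) ^ DIM(real^'n) * (sqrt (512/1831) * exp (- 1/4)) ^ card K
        / exp (- (7 / (2 * \<sigma>\<^sup>2)) * (N * \<sigma>\<^sup>2 / 8 + (1/16)\<^sup>2 * (4 * N * \<sigma>\<^sup>2)))"
    by blast
  note G2p
  also have "- (7 / (2 * \<sigma>\<^sup>2)) * (N * \<sigma>\<^sup>2 / 8 + (1/16)\<^sup>2 * (4 * N * \<sigma>\<^sup>2)) = - (63/128 * N)"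
    using \<sigma> by (simp add: field_simps power2_eq_square)
  also have "(sqrt (512/1831) * exp (- 1/4)) ^ card K = exp (N * (- ln (1831/512) / 2 - 1/4))"
  proof -
    have "ln (sqrt (512/1831) * exp (- 1/4)) = - ln (1831/512) / 2 - (1/4 :: real)"
      by (subst ln_mult) (simp_all add: ln_sqrt ln_div)
    thus ?thesis by (subst power_eq_exp_ln) (auto simp: N_def)
  qed
  also have "((1 + 1/16) / (1/16)) ^ DIM(real^'n) * exp (N * (- ln (1831/512) / 2 - 1/4)) / exp (- (63/128 * N)) =
      exp (real CARD('n) * ln 17 + N * (- ln (1831/512) / 2 - 1/4) + 63/128 * N)"
  proof -
    have "((1 + 1/16) / (1/16) :: real) ^ DIM(real^'n) = exp (real CARD('n) * ln 17)"
      by (subst power_eq_exp_ln) auto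
    thus ?thesis by (simp only: exp_diff[symmetric] exp_add[symmetric] diff_minus_eq_add)
  qed
  also have "\<dots> \<le> exp (- L)"
  proof -
    \<comment> \<open>By \<open>large\<close> the dimension is at most N / 8 - 2 L, so the
      coefficient of N becomes 409/1152 + 63/128 - 17/20. This is negative by less than 3/1000,
      hence the care with the numerical logarithms.\<close>
    have "real CARD('n) * ln 17 \<le> real CARD('n) * (409/144)" by (intro mult_left_mono ln_numeral_bounds) simp
    moreover have "N * (- ln (1831/512) / 2 - 1/4) \<le> N * (- (6/5) / 2 - 1/4)"
      using N ln_numeral_bounds(5) by (intro mult_left_mono) auto
    ultimately have "real CARD('n) * ln 17 + N * (- ln (1831/512) / 2 - 1/4) + 63/128 * N
        \<le> real CARD('n) * (409/144) + N * (- (6/5) / 2 - 1/4) + 63/128 * N"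
      by (intro add_mono order_refl)
    also have "\<dots> \<le> - L" using N n1 L by (simp add: field_simps)
    finally show ?thesis by simp
  qed
  finally have P2: "prob (space M - G2) \<le> exp (- L)" .
  show ?thesis
  proof (intro bexI[of _ "G1 \<inter> G2"] conjI ballI allI)
    have "prob (space M - G1 \<inter> G2) \<le> prob (space M - G1) + prob (space M - G2)"
      using G1(1) G2(1) unfolding Diff_Int by (intro measure_Un_le) auto
    thus "prob (space M - G1 \<inter> G2) \<le> 2 * exp (- L)" using P1 P2 by simp
    show "G1 \<inter> G2 \<in> events" using G1(1) G2(1) by auto
    fix \<omega> v assume "\<omega> \<in> G1 \<inter> G2"
    thus "real (card K) * \<sigma>\<^sup>2 / 8 * ((norm v)\<^sup>2 + 2 / (real (card K) * \<sigma>\<^sup>2) * (\<Sum>k\<in>K. (mu k \<bullet> v)\<^sup>2)) \<le> (\<Sum>k\<in>K. (X k \<omega> \<bullet> v)\<^sup>2)"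
      using G2(2)[of \<omega> v] G1(2)[of \<omega>] by (simp add: p2 Q_def N_def)
  qed
qed

text \<open>The design is fixed here. The squared coefficients of the noise sum add up to (p v)^2,
  so its exponential moment is a function of \<open>p v\<close> alone and the constants depend on
  neither the design nor \<alpha>.\<close>

lemma iso_gauss_noise_upper_bound:
  fixes x :: "'k \<Rightarrow> real^'n" and H :: "'k \<Rightarrow> 'a \<Rightarrow> real^'l"
  assumes H: "\<And>k. k \<in> K \<Longrightarrow> distributed M lborel (H k) (\<lambda>v. ennreal (iso_gauss_density 0 \<sigma> v))"
    and ind: "indep_vars (\<lambda>_. borel) H K" and K: "finite K" and \<sigma>: "0 < \<sigma>"
    and \<alpha>: "0 < \<alpha>" and lower: "\<And>v. \<alpha>\<^sup>2 * (norm v)\<^sup>2 \<le> (\<Sum>k\<in>K. (x k \<bullet> v)\<^sup>2)"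
  shows "\<exists>G\<in>events. prob (space M - G) \<le> exp (- L) \<and>
    (\<forall>\<omega>\<in>G. \<forall>v. (norm (\<Sum>k\<in>K. (x k \<bullet> v) *\<^sub>R H k \<omega>))\<^sup>2 \<le>
      \<sigma>\<^sup>2 * (10 * real CARD('n) + 2 * real CARD('l) + 4 * L) * (\<Sum>k\<in>K. (x k \<bullet> v)\<^sup>2))"
proof -
  define p where "p v = sqrt (0 * (norm v)\<^sup>2 + (\<Sum>k\<in>K. (x k \<bullet> v)\<^sup>2))" for v
  interpret vector_norm p \<alpha>
    unfolding p_def by (rule vector_norm_quadratic) (use \<alpha> lower in auto)
  have p2: "(p v)\<^sup>2 = (\<Sum>k\<in>K. (x k \<bullet> v)\<^sup>2)" for v
    by (simp add: p_def sum_nonneg)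
  define Z where "Z \<omega> v = (\<Sum>k\<in>K. (x k \<bullet> v) *\<^sub>R H k \<omega>)" for \<omega> v
  define R where "R = \<sigma>\<^sup>2 * (10 * real CARD('n) + 2 * real CARD('l) + 4 * L)"
  have [measurable]: "H k \<in> borel_measurable M" if "k \<in> K" for k
    using ind that by (auto simp: indep_vars_def)
  have meas: "(\<lambda>(\<omega>, w). (norm (Z \<omega> w))\<^sup>2) \<in> borel_measurable (M \<Otimes>\<^sub>M borel)"
    unfolding Z_def by measurable
  have Zadd: "Z \<omega> (v + z) = Z \<omega> v + Z \<omega> z" "Z \<omega> (v - z) = Z \<omega> v - Z \<omega> z" "Z \<omega> (r *\<^sub>R v) = r *\<^sub>R Z \<omega> v" for \<omega> v z r
    by (simp_all add: Z_def inner_add_right inner_diff_right scaleR_add_left scaleR_diff_left sum.distrib sum_subtractf scaleR_sum_right)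
  have par: "(norm (Z \<omega> (v + z)))\<^sup>2 + (norm (Z \<omega> (v - z)))\<^sup>2 = 2 * (norm (Z \<omega> v))\<^sup>2 + 2 * (norm (Z \<omega> z))\<^sup>2" for \<omega> v z
    by (simp add: Zadd power2_norm_eq_inner inner_add_left inner_add_right inner_diff_left inner_diff_right)
  \<comment> \<open>With \<tau> = 1/4 and p w <= 11/10 the determinant is at least 1 - 121/200 =
    79/200. The three terms of R / (4 \<sigma>^2), namely 5n/2, l/2 and L, pay for 11^n, for
    (200/79)^(l/2) and for the confidence; this is the origin of 10 n + 2 l + 4 L.\<close>
  have "\<exists>G\<in>events. prob (space M - G) \<le> ((1 + 1/10) / (1/10)) ^ DIM(real^'n) * sqrt (200/79) ^ CARD('l) / exp ((1/4) / \<sigma>\<^sup>2 * R) \<and>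
    (\<forall>\<omega>\<in>G. \<forall>v. (norm (Z \<omega> v))\<^sup>2 \<le> R * (p v)\<^sup>2)"
  proof (rule quadratic_upper_tail[OF prob_space_axioms _ _ _ meas par])
    fix w assume "p w \<le> 1 + 1/10"
    hence "(p w)\<^sup>2 \<le> (11/10)\<^sup>2" using nonneg[of w] by (intro power_mono) auto
    hence "(\<Sum>k\<in>K. (x k \<bullet> w)\<^sup>2) \<le> 121/100" unfolding p2 by (simp add: power_divide)
    hence Y: "79/200 \<le> 1 - 2 * (1/4) * (\<Sum>k\<in>K. (x k \<bullet> w)\<^sup>2)" by simp
    have "(\<integral>\<^sup>+\<omega>. ennreal (exp ((1/4) / \<sigma>\<^sup>2 * (norm (Z \<omega> w))\<^sup>2)) \<partial>M) =
      ennreal ((1 / sqrt (1 - 2 * (1/4) * (\<Sum>k\<in>K. (x k \<bullet> w)\<^sup>2))) ^ CARD('l))"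
      unfolding Z_def by (rule iso_gauss_family_exp_norm[OF H ind K \<sigma>]) (use Y in auto)
    also have "\<dots> \<le> ennreal (sqrt (200/79) ^ CARD('l))"
    proof (intro ennreal_leI power_mono)
      have "1 / sqrt (1 - 2 * (1/4) * (\<Sum>k\<in>K. (x k \<bullet> w)\<^sup>2)) \<le> 1 / sqrt (79/200)"
        using Y by (intro divide_left_mono mult_pos_pos real_sqrt_le_mono) auto
      thus "1 / sqrt (1 - 2 * (1/4) * (\<Sum>k\<in>K. (x k \<bullet> w)\<^sup>2)) \<le> sqrt (200/79)"
        by (simp add: real_sqrt_divide)
    qed (use Y in auto)
    finally show "(\<integral>\<^sup>+\<omega>. ennreal (exp ((1/4) / \<sigma>\<^sup>2 * (norm (Z \<omega> w))\<^sup>2)) \<partial>M) \<le> ennreal (sqrt (200/79) ^ CARD('l))" .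
  qed (use \<sigma> in \<open>auto simp: Zadd power_mult_distrib\<close>)
  then obtain G where G: "G \<in> events" "\<And>\<omega> v. \<omega> \<in> G \<Longrightarrow> (norm (Z \<omega> v))\<^sup>2 \<le> R * (p v)\<^sup>2"
    and Gp: "prob (space M - G) \<le> ((1 + 1/10) / (1/10)) ^ DIM(real^'n) * sqrt (200/79) ^ CARD('l) / exp ((1/4) / \<sigma>\<^sup>2 * R)"
    by blast
  note Gp
  also have "(1/4) / \<sigma>\<^sup>2 * R = 5/2 * real CARD('n) + real CARD('l) / 2 + L"
    using \<sigma> by (simp add: R_def)
  also have "((1 + 1/10) / (1/10)) ^ DIM(real^'n) * sqrt (200/79) ^ CARD('l) / exp (5/2 * real CARD('n) + real CARD('l) / 2 + L) =
    exp (real CARD('n) * ln 11 + real CARD('l) * (ln (200/79) / 2) - (5/2 * real CARD('n) + real CARD('l) / 2 + L))"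
  proof -
    have "sqrt (200/79 :: real) ^ CARD('l) = exp (real CARD('l) * (ln (200/79) / 2))"
      by (subst power_eq_exp_ln) (auto simp: ln_sqrt)
    moreover have "((1 + 1/10) / (1/10) :: real) ^ DIM(real^'n) = exp (real CARD('n) * ln 11)"
      by (subst power_eq_exp_ln) auto
    ultimately show ?thesis by (simp only: exp_add exp_diff)
  qed
  also have "\<dots> \<le> exp (- L)"
  proof -
    have "real CARD('n) * ln 11 \<le> real CARD('n) * (5/2)" by (intro mult_left_mono ln_numeral_bounds) simp
    moreover have "real CARD('l) * (ln (200/79) / 2) \<le> real CARD('l) * (1 / 2)"
      using ln_numeral_bounds(4) by (intro mult_left_mono) auto
    ultimately show ?thesis unfolding exp_le_cancel_iff by linarith
  qed
  finally show ?thesis using G by (auto simp: R_def Z_def p2 intro!: bexI[of _ G])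
qed

end

section \<open>The error bound\<close>

text \<open>The bound on \<Lambda> gives \<sigma> sqrt \<Lambda> <= \<sigma> + 2 \<mu> / sqrt n,
  which splits the numerator into the two terms of the stated constant. The term without means needs
  T \<sigma> <= 2 A; in the other, 1 / sqrt n compensates the growth of T through T <= sqrt n
  B.\<close>

lemma error_bound_arith:
  fixes n l L L' \<mu> \<sigma> \<rho> N \<Lambda> :: real
  assumes n: "1 \<le> n" and l: "1 \<le> l" and L: "2 \<le> L" "L \<le> L'" and \<mu>: "0 \<le> \<mu>" and \<sigma>: "0 < \<sigma>" and \<rho>: "0 < \<rho>"
    and N: "0 < N" and \<Lambda>: "1 \<le> \<Lambda>" "\<Lambda> \<le> 1 + 4 * (\<mu> / \<sigma>)\<^sup>2 / n"
  shows "\<rho> * sqrt (10 * n + 2 * l + 4 * L) / sqrt (N * \<sigma>\<^sup>2 * (1 + \<Lambda>) / 16) \<le>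
    8 * \<rho> * (4 * \<sigma> * sqrt ((n + l) * L') + \<mu> * (sqrt (2 * (l + n)) + 2 * sqrt L)) / (sqrt N * \<sigma>\<^sup>2 * \<Lambda>)"
proof -
  define T where "T = sqrt (10 * n + 2 * l + 4 * L)"
  define A where "A = 4 * \<sigma> * sqrt ((n + l) * L')"
  define B where "B = sqrt (2 * (l + n)) + 2 * sqrt L"
  have T0: "0 \<le> T" using n l L by (simp add: T_def)
  have AB: "0 \<le> A" "0 \<le> B" using n l L \<sigma> by (auto simp: A_def B_def)
  have T1: "T * \<sigma> \<le> 2 * A"
  proof -
    have "2 * (n + l) \<le> (n + l) * L'" using n l L by (subst mult.commute) (intro mult_left_mono, auto)
    moreover have "1 * L \<le> (n + l) * L'" using n l L by (intro mult_mono) auto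
    ultimately have "10 * n + 2 * l + 4 * L \<le> 8\<^sup>2 * ((n + l) * L')" using n l L by simp
    hence "T \<le> sqrt (8\<^sup>2 * ((n + l) * L'))" unfolding T_def by (rule real_sqrt_le_mono)
    hence "T \<le> 8 * sqrt ((n + l) * L')" by (simp add: real_sqrt_mult)
    thus ?thesis using \<sigma> by (simp add: A_def mult_right_mono mult_ac)
  qed
  have T2: "T \<le> sqrt n * B"
  proof -
    define a b where "a = sqrt (2 * (l + n))" and "b = sqrt L"
    have a2: "a\<^sup>2 = 2 * (l + n)" "b\<^sup>2 = L" using n l L by (auto simp: a_def b_def)
    \<comment> \<open>The cross term 4 a b of B^2 has to supply the 10 that matches 10 n in T^2; a
      >= 2 and b >= 5/4 suffice.\<close>
    have "2 \<le> a" unfolding a_def using n l by (intro real_le_rsqrt) (simp add: power2_eq_square)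
    moreover have "5/4 \<le> b" unfolding b_def using L by (intro real_le_rsqrt) (simp add: power2_eq_square)
    ultimately have "2 * (5/4) \<le> a * b" by (intro mult_mono) auto
    moreover have "B\<^sup>2 = a\<^sup>2 + 4 * (a * b) + 4 * b\<^sup>2"
      by (simp add: B_def a_def b_def power2_eq_square algebra_simps)
    ultimately have "2 * (l + n) + 10 + 4 * L \<le> B\<^sup>2" using a2 by simp
    hence "n * (2 * (l + n) + 10 + 4 * L) \<le> n * B\<^sup>2" using n by (intro mult_left_mono) auto
    moreover have "2 * l \<le> n * (2 * l)" "4 * L \<le> n * (4 * L)" "0 \<le> n * (2 * n)"
      using n l L mult_right_mono[of 1 n "2 * l"] mult_right_mono[of 1 n "4 * L"] by auto
    moreover have "n * (2 * (l + n) + 10 + 4 * L) = n * (2 * l) + n * (2 * n) + 10 * n + n * (4 * L)"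
      by (simp add: algebra_simps)
    ultimately have "10 * n + 2 * l + 4 * L \<le> n * B\<^sup>2" by linarith
    hence "T \<le> sqrt (n * B\<^sup>2)" unfolding T_def by (rule real_sqrt_le_mono)
    thus ?thesis using AB by (simp add: real_sqrt_mult)
  qed
  have S: "sqrt \<Lambda> * \<sigma> \<le> \<sigma> + 2 * \<mu> / sqrt n"
  proof -
    define a where "a = 2 * (\<mu> / \<sigma>) / sqrt n"
    have a0: "0 \<le> a" using \<mu> \<sigma> n by (simp add: a_def)
    have "a\<^sup>2 = 4 * (\<mu> / \<sigma>)\<^sup>2 / n" using n by (simp add: a_def power_divide power_mult_distrib)
    hence "\<Lambda> \<le> 1 + a\<^sup>2" using \<Lambda>(2) by simp
    also have "\<dots> \<le> (1 + a)\<^sup>2" using a0 by (simp add: power2_sum)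
    finally have "\<Lambda> \<le> (1 + 2 * (\<mu> / \<sigma>) / sqrt n)\<^sup>2" by (simp add: a_def)
    hence "sqrt \<Lambda> \<le> 1 + 2 * (\<mu> / \<sigma>) / sqrt n"
      using \<mu> \<sigma> n by (intro real_le_lsqrt) auto
    hence "sqrt \<Lambda> * \<sigma> \<le> (1 + 2 * (\<mu> / \<sigma>) / sqrt n) * \<sigma>" using \<sigma> by (intro mult_right_mono) auto
    thus ?thesis using \<sigma> by (simp add: field_simps)
  qed
  have "T * (sqrt \<Lambda> * \<sigma>) \<le> T * (\<sigma> + 2 * \<mu> / sqrt n)" using S T0 by (rule mult_left_mono)
  also have "\<dots> = T * \<sigma> + T * (2 * \<mu> / sqrt n)" by (simp add: distrib_left)
  also have "T * (2 * \<mu> / sqrt n) \<le> sqrt n * B * (2 * \<mu> / sqrt n)"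
    using T2 n \<mu> by (intro mult_right_mono) auto
  also have "sqrt n * B * (2 * \<mu> / sqrt n) = 2 * (\<mu> * B)" using n by simp
  also have "T * \<sigma> + 2 * (\<mu> * B) \<le> 2 * (A + \<mu> * B)" using T1 by simp
  finally have key: "T * (sqrt \<Lambda> * \<sigma>) \<le> 2 * (A + \<mu> * B)" by simp
  \<comment> \<open>One factor sqrt \<Lambda> is spent in \<open>key\<close>; the other is absorbed
    by the sqrt (1 + \<Lambda>) that the design bound provides.\<close>
  have "T * \<sigma> * \<Lambda> = T * (sqrt \<Lambda> * \<sigma>) * sqrt \<Lambda>" using \<Lambda> by simp
  also have "\<dots> \<le> 2 * (A + \<mu> * B) * sqrt \<Lambda>" using \<Lambda> key by (intro mult_right_mono) auto
  also have "\<dots> \<le> 2 * (A + \<mu> * B) * sqrt (1 + \<Lambda>)" using AB \<mu> \<Lambda> by (intro mult_left_mono) auto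
  finally have fin: "T * \<sigma> * \<Lambda> \<le> 2 * (A + \<mu> * B) * sqrt (1 + \<Lambda>)" .
  have "\<rho> * T / sqrt (N * \<sigma>\<^sup>2 * (1 + \<Lambda>) / 16) = 4 * \<rho> * T / (sqrt N * \<sigma> * sqrt (1 + \<Lambda>))"
    using \<sigma> by (simp add: real_sqrt_mult real_sqrt_divide)
  also have "\<dots> \<le> 8 * \<rho> * (A + \<mu> * B) / (sqrt N * \<sigma>\<^sup>2 * \<Lambda>)"
  proof -
    have pos: "0 < sqrt N * \<sigma> * sqrt (1 + \<Lambda>)" "0 < sqrt N * \<sigma>\<^sup>2 * \<Lambda>" using N \<sigma> \<Lambda> by auto
    have "4 * \<rho> * T * (sqrt N * \<sigma>\<^sup>2 * \<Lambda>) = 4 * \<rho> * sqrt N * \<sigma> * (T * \<sigma> * \<Lambda>)"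
      by (simp add: power2_eq_square mult_ac)
    also have "\<dots> \<le> 4 * \<rho> * sqrt N * \<sigma> * (2 * (A + \<mu> * B) * sqrt (1 + \<Lambda>))"
      using fin \<rho> N \<sigma> by (intro mult_left_mono) auto
    also have "\<dots> = 8 * \<rho> * (A + \<mu> * B) * (sqrt N * \<sigma> * sqrt (1 + \<Lambda>))" by (simp add: mult_ac)
    finally show ?thesis using pos by (simp only: pos_divide_le_eq times_divide_eq_left pos_le_divide_eq)
  qed
  finally show ?thesis by (simp add: T_def A_def B_def)
qed

context prob_space
begin

text \<open>The fixed-design estimate is transferred to the random design by the section bound. This
  works because its right-hand side is the same for every design satisfying the lower bound.\<close>

lemma iso_gauss_noise_uniform_bound:
  fixes X :: "'k \<Rightarrow> 'a \<Rightarrow> real^'n" and H :: "'k \<Rightarrow> 'a \<Rightarrow> real^'l"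
  assumes XH: "\<And>k. k \<in> K \<Longrightarrow> distributed M lborel (\<lambda>\<omega>. (X k \<omega>, H k \<omega>))
      (\<lambda>z. ennreal (case z of (u, v) \<Rightarrow> iso_gauss_density (mu k) \<sigma> u * iso_gauss_density 0 \<rho> v))"
    and ind: "indep_vars (\<lambda>_. borel) (\<lambda>k \<omega>. (X k \<omega>, H k \<omega>)) K"
    and K: "finite K" "K \<noteq> {}" and \<sigma>: "0 < \<sigma>" and \<rho>: "0 < \<rho>" and \<alpha>: "0 < \<alpha>"
  shows "\<exists>G\<in>events. prob (space M - G) \<le> exp (- L) \<and>
    (\<forall>\<omega>\<in>G. (\<forall>v. \<alpha>\<^sup>2 * (norm v)\<^sup>2 \<le> (\<Sum>k\<in>K. (X k \<omega> \<bullet> v)\<^sup>2)) \<longrightarrow>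
      (\<forall>v. (norm (\<Sum>k\<in>K. (X k \<omega> \<bullet> v) *\<^sub>R H k \<omega>))\<^sup>2 \<le>
        \<rho>\<^sup>2 * (10 * real CARD('n) + 2 * real CARD('l) + 4 * L) * (\<Sum>k\<in>K. (X k \<omega> \<bullet> v)\<^sup>2)))"
proof -
  have marg: "distributed M lborel (H k) (\<lambda>v. ennreal (iso_gauss_density 0 \<rho> v))" if "k \<in> K" for k
    using iso_gauss_pair_marginals(2)[OF XH[OF that] \<sigma> \<rho>] .
  note fam = pair_families_independent[OF ind K iso_gauss_pair_marginals(3)[OF XH \<sigma> \<rho>]]
  have iX: "indep_vars (\<lambda>_. borel) X K" and iH: "indep_vars (\<lambda>_. borel) H K"
    by (rule fam(1); assumption) (rule fam(2); assumption)
  have [measurable]: "X k \<in> borel_measurable M" "H k \<in> borel_measurable M" if "k \<in> K" for k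
    using iX iH that by (auto simp: indep_vars_def)
  \<comment> \<open>The section bound needs a measurable bad set, but its conditions quantify over
    all vectors. They are closed in \<open>v\<close>, so a countable dense set of vectors
    suffices.\<close>
  obtain D :: "(real^'n) set" where D: "countable D" and dense: "\<And>U. open U \<Longrightarrow> U \<noteq> {} \<Longrightarrow> \<exists>d\<in>D. d \<in> U"
    using countable_dense_exists[where 'a = "real^'n"] by auto
  have "D \<noteq> {}" using dense[of UNIV] by auto
  with D obtain d :: "nat \<Rightarrow> real^'n" where d: "D = range d"
    using range_from_nat_into by metis
  have ext: "S = UNIV" if "closed S" "D \<subseteq> S" for S
    using that dense[of "- S"] by (auto simp: open_Compl)
  define R where "R = \<rho>\<^sup>2 * (10 * real CARD('n) + 2 * real CARD('l) + 4 * L)"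
  define low where "low x v \<longleftrightarrow> \<alpha>\<^sup>2 * (norm v)\<^sup>2 \<le> (\<Sum>k\<in>K. (x k \<bullet> v)\<^sup>2)" for x :: "'k \<Rightarrow> real^'n" and v
  define up where "up x h v \<longleftrightarrow> (norm (\<Sum>k\<in>K. (x k \<bullet> v) *\<^sub>R h k))\<^sup>2 \<le> R * (\<Sum>k\<in>K. (x k \<bullet> v)\<^sup>2)"
    for x :: "'k \<Rightarrow> real^'n" and h :: "'k \<Rightarrow> real^'l" and v
  have low_ext: "low x v" if "\<forall>v\<in>D. low x v" for x v
  proof -
    have "closed {v. low x v}" unfolding low_def by (intro closed_Collect_le continuous_intros)
    from ext[OF this] that show ?thesis by auto
  qed
  have up_ext: "up x h v" if "\<forall>v\<in>D. up x h v" for x h v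
  proof -
    have "closed {v. up x h v}" unfolding up_def by (intro closed_Collect_le continuous_intros)
    from ext[OF this] that show ?thesis by auto
  qed
  let ?S = "PiM K (\<lambda>_. borel :: (real^'n) measure)"
  let ?T = "PiM K (\<lambda>_. borel :: (real^'l) measure)"
  \<comment> \<open>Bad means that the design obeys the lower bound and the noise bound fails.
    Sections over designs violating the lower bound are empty, so every section has small
    probability.\<close>
  define B where "B = {z \<in> space (?S \<Otimes>\<^sub>M ?T). (\<forall>v\<in>D. low (fst z) v) \<and> \<not> (\<forall>v\<in>D. up (fst z) (snd z) v)}"
  have c1[measurable]: "(\<lambda>z. fst z k) \<in> borel_measurable (?S \<Otimes>\<^sub>M ?T)" if "k \<in> K" for k
    by (rule measurable_compose[OF measurable_fst measurable_component_singleton[OF that]])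
  have c2[measurable]: "(\<lambda>z. snd z k) \<in> borel_measurable (?S \<Otimes>\<^sub>M ?T)" if "k \<in> K" for k
    by (rule measurable_compose[OF measurable_snd measurable_component_singleton[OF that]])
  have [measurable]: "Measurable.pred (?S \<Otimes>\<^sub>M ?T) (\<lambda>z. low (fst z) v)" for v
    unfolding low_def by measurable
  have [measurable]: "Measurable.pred (?S \<Otimes>\<^sub>M ?T) (\<lambda>z. up (fst z) (snd z) v)" for v
    unfolding up_def by measurable
  have [measurable]: "Measurable.pred (?S \<Otimes>\<^sub>M ?T) (\<lambda>z. \<forall>v\<in>D. low (fst z) v)"
    unfolding d ball_simps by measurable
  have [measurable]: "Measurable.pred (?S \<Otimes>\<^sub>M ?T) (\<lambda>z. \<forall>v\<in>D. up (fst z) (snd z) v)"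
    unfolding d ball_simps by measurable
  have B: "B \<in> sets (?S \<Otimes>\<^sub>M ?T)"
    unfolding B_def by measurable
  have low_cong: "low (\<lambda>k\<in>K. X k \<omega>) v = low (\<lambda>k. X k \<omega>) v" for \<omega> v by (simp add: low_def)
  have up_cong: "up x (\<lambda>k\<in>K. H k \<omega>) v = up x (\<lambda>k. H k \<omega>) v" "up (\<lambda>k\<in>K. X k \<omega>) h v = up (\<lambda>k. X k \<omega>) h v" for x h \<omega> v
    by (simp_all add: up_def)
  have PB: "prob {\<omega> \<in> space M. (\<lambda>k\<in>K. X k \<omega>, \<lambda>k\<in>K. H k \<omega>) \<in> B} \<le> exp (- L)"
  proof (rule fam(3)[OF _ _ _ B])
    fix x assume x: "x \<in> space ?S"
    show "prob {\<omega> \<in> space M. (x, \<lambda>k\<in>K. H k \<omega>) \<in> B} \<le> exp (- L)"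
    proof (cases "\<forall>v\<in>D. low x v")
      case False
      hence "{\<omega> \<in> space M. (x, \<lambda>k\<in>K. H k \<omega>) \<in> B} = {}" by (auto simp: B_def)
      thus ?thesis by (simp only: measure_empty exp_ge_zero)
    next
      case True
      have "\<alpha>\<^sup>2 * (norm v)\<^sup>2 \<le> (\<Sum>k\<in>K. (x k \<bullet> v)\<^sup>2)" for v
        using low_ext[OF True, of v] by (simp add: low_def)
      from iso_gauss_noise_upper_bound[OF marg iH K(1) \<rho> \<alpha> this, of L]
      obtain G where G: "G \<in> events" "prob (space M - G) \<le> exp (- L)" "\<And>\<omega> v. \<omega> \<in> G \<Longrightarrow> up x (\<lambda>k. H k \<omega>) v"
        unfolding up_def R_def by blast
      have "{\<omega> \<in> space M. (x, \<lambda>k\<in>K. H k \<omega>) \<in> B} \<subseteq> space M - G"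
        using G(3) by (auto simp: B_def up_cong)
      hence "prob {\<omega> \<in> space M. (x, \<lambda>k\<in>K. H k \<omega>) \<in> B} \<le> prob (space M - G)"
        using G(1) by (intro finite_measure_mono) auto
      thus ?thesis using G(2) by simp
    qed
  qed
  define E where "E = {\<omega> \<in> space M. (\<lambda>k\<in>K. X k \<omega>, \<lambda>k\<in>K. H k \<omega>) \<in> B}"
  have mXH: "(\<lambda>\<omega>. (\<lambda>k\<in>K. X k \<omega>, \<lambda>k\<in>K. H k \<omega>)) \<in> measurable M (?S \<Otimes>\<^sub>M ?T)"
    by (intro measurable_Pair measurable_restrict) auto
  have E: "E \<in> events" 
    using measurable_sets[OF mXH B] by (simp add: E_def vimage_def Int_def conj_commute)
  have "prob (space M - (space M - E)) \<le> exp (- L)"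
    using PB sets.sets_into_space[OF E] by (simp add: double_diff flip: E_def)
  moreover have "up (\<lambda>k. X k \<omega>) (\<lambda>k. H k \<omega>) v" if "\<omega> \<in> space M - E" "\<And>v. low (\<lambda>k. X k \<omega>) v" for \<omega> v
  proof -
    have "(\<lambda>k\<in>K. X k \<omega>, \<lambda>k\<in>K. H k \<omega>) \<in> space (?S \<Otimes>\<^sub>M ?T)"
      using measurable_space[OF mXH] that(1) by auto
    hence "\<forall>v\<in>D. up (\<lambda>k. X k \<omega>) (\<lambda>k. H k \<omega>) v"
      using that by (auto simp: E_def B_def low_cong up_cong)
    thus ?thesis by (rule up_ext)
  qed
  ultimately show ?thesis
    using E by (intro bexI[of _ "space M - E"]) (auto simp: low_def up_def R_def)
qed

end

theorem theorem2:
  fixes M :: "'a measure"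
    and m :: nat and t :: nat
    and \<Theta> :: "real^'n^'l"
    and x :: "nat \<Rightarrow> nat \<Rightarrow> 'a \<Rightarrow> real^'n"
    and \<eta> :: "nat \<Rightarrow> nat \<Rightarrow> 'a \<Rightarrow> real^'l"
    and \<mu> :: "nat \<Rightarrow> nat \<Rightarrow> real^'n"
    and \<sigma>x \<sigma>\<eta> \<mu>hat \<delta> :: real
  assumes P: "prob_space M"
    and m_pos: "m \<ge> 1"
    and sx: "\<sigma>x > 0" and se: "\<sigma>\<eta> > 0"
    and joint_dist: "\<And>i j. i \<in> {1..m} \<Longrightarrow> j \<ge> 1 \<Longrightarrow>
        distributed M lborel (\<lambda>\<omega>. (x i j \<omega>, \<eta> i j \<omega>))
          (\<lambda>(u, v). iso_gauss_density (\<mu> i j) \<sigma>x u * iso_gauss_density 0 \<sigma>\<eta> v)"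
    and indep_all: "prob_space.indep_vars M (\<lambda>_. borel)
        (\<lambda>(i, j) \<omega>. (x i j \<omega>, \<eta> i j \<omega>)) ({1..m} \<times> {1..})"
    and mu_bdd: "bdd_above ((\<lambda>(i, j). norm (\<mu> i j)) ` ({1..m} \<times> {1..}))"
    and muhat_def: "\<mu>hat = (SUP (i, j)\<in>{1..m} \<times> {1..}. norm (\<mu> i j))"
    and delta_pos: "\<delta> > 0"
    and t_ge: "real t \<ge> (1 / real m) * Max {
        8 * real CARD('n) + 16 * ln (2 / \<delta>),
        (16 * \<mu>hat * (sqrt (4 * real CARD('n)) + sqrt (2 * ln (2 / \<delta>))) / \<sigma>x)\<^sup>2,
        2 * (real CARD('n) + real CARD('l)) * ln (1 / \<delta>)}"
  shows "measure M {\<omega> \<in> space M.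
      spec_norm ((\<Sum>i=1..m. \<Sum>j=1..t. outer (\<Theta> *v x i j \<omega> + \<eta> i j \<omega>) (x i j \<omega>))
                 ** matrix_inv (\<Sum>i=1..m. \<Sum>j=1..t. outer (x i j \<omega>) (x i j \<omega>)) - \<Theta>)
      \<le> (8 * \<sigma>\<eta> * (4 * \<sigma>x * sqrt ((real CARD('n) + real CARD('l)) * ln (9 / \<delta>))
              + \<mu>hat * (sqrt (2 * (real CARD('l) + real CARD('n))) + 2 * sqrt (ln (2 / \<delta>)))))
        / (sqrt (real m * real t) * \<sigma>x\<^sup>2 *
           lambda_min (mat 1 + (4 / (real m * real t * \<sigma>x\<^sup>2)) *\<^sub>R
              (\<Sum>i=1..m. \<Sum>j=1..t. outer (\<mu> i j) (\<mu> i j))))}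
    \<ge> 1 - 4 * \<delta>"
proof -
  interpret prob_space M by fact
  let ?bound = "(8 * \<sigma>\<eta> * (4 * \<sigma>x * sqrt ((real CARD('n) + real CARD('l)) * ln (9 / \<delta>))
              + \<mu>hat * (sqrt (2 * (real CARD('l) + real CARD('n))) + 2 * sqrt (ln (2 / \<delta>)))))
        / (sqrt (real m * real t) * \<sigma>x\<^sup>2 *
           lambda_min (mat 1 + (4 / (real m * real t * \<sigma>x\<^sup>2)) *\<^sub>R
              (\<Sum>i=1..m. \<Sum>j=1..t. outer (\<mu> i j) (\<mu> i j))))"
  let ?err = "\<lambda>\<omega>. spec_norm ((\<Sum>i=1..m. \<Sum>j=1..t. outer (\<Theta> *v x i j \<omega> + \<eta> i j \<omega>) (x i j \<omega>))
                 ** matrix_inv (\<Sum>i=1..m. \<Sum>j=1..t. outer (x i j \<omega>) (x i j \<omega>)) - \<Theta>)"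
  show ?thesis
  \<comment> \<open>For larger \<delta> the claimed probability is not positive. Otherwise L exceeds
    ln 8, which provides the \<open>2 \<le> L\<close> used in
    \<open>error_bound_arith\<close>.\<close>
  proof (cases "\<delta> < 1/4")
    case False
    hence "1 - 4 * \<delta> \<le> 0" by simp
    thus ?thesis by (rule order_trans) simp
  next
    case True
    define K where "K = {1..m} \<times> {1..t}"
    define X where "X k = x (fst k) (snd k)" for k
    define H where "H k = \<eta> (fst k) (snd k)" for k
    define mu where "mu k = \<mu> (fst k) (snd k)" for k
    define L where "L = ln (2 / \<delta>)"
    define N where "N = real (card K)"
    have N_eq: "N = real m * real t" by (simp add: N_def K_def)
    have dsum: "(\<Sum>i=1..m. \<Sum>j=1..t. f i j) = (\<Sum>k\<in>K. f (fst k) (snd k))" for f :: "nat \<Rightarrow> nat \<Rightarrow> real^'c^'d"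
      unfolding K_def by (subst sum.cartesian_product) (simp add: split_def)
    have L2: "2 \<le> L"
    proof -
      have "ln (2 ^ 3) \<le> ln (2 / \<delta>)" using True delta_pos by (intro ln_mono) (auto simp: field_simps)
      moreover have "2 \<le> ln (2 ^ 3 :: real)" using ln2_ge_two_thirds by (subst ln_realpow) auto
      ultimately show ?thesis by (simp add: L_def)
    qed
    have eL: "exp (- L) = \<delta> / 2" using delta_pos by (simp add: L_def exp_minus)
    have N_ge: "8 * real CARD('n) + 16 * L \<le> N"
    proof -
      have "8 * real CARD('n) + 16 * L \<le> Max {8 * real CARD('n) + 16 * ln (2 / \<delta>),
        (16 * \<mu>hat * (sqrt (4 * real CARD('n)) + sqrt (2 * ln (2 / \<delta>))) / \<sigma>x)\<^sup>2,
        2 * (real CARD('n) + real CARD('l)) * ln (1 / \<delta>)}" unfolding L_def by (intro Max_ge) auto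
      also have "\<dots> \<le> real m * real t" using t_ge m_pos by (simp add: field_simps)
      finally show ?thesis by (simp add: N_eq)
    qed
    have N0: "0 < N"
    proof -
      have "0 \<le> real CARD('n)" by simp
      thus ?thesis using N_ge L2 by linarith
    qed
    have K: "finite K" "K \<noteq> {}" using N0 by (simp add: K_def) (use N0 in \<open>auto simp: N_def\<close>)
    have Ksub: "K \<subseteq> {1..m} \<times> {1..}" by (auto simp: K_def)
    have XH: "distributed M lborel (\<lambda>\<omega>. (X k \<omega>, H k \<omega>))
      (\<lambda>z. ennreal (case z of (u, v) \<Rightarrow> iso_gauss_density (mu k) \<sigma>x u * iso_gauss_density 0 \<sigma>\<eta> v))" if "k \<in> K" for k
      using joint_dist[of "fst k" "snd k"] that by (auto simp: K_def X_def H_def mu_def split_def)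
    have ind: "indep_vars (\<lambda>_. borel) (\<lambda>k \<omega>. (X k \<omega>, H k \<omega>)) K"
      using indep_vars_subset[OF indep_all Ksub] by (simp add: X_def H_def split_def)
    have Xdist: "distributed M lborel (X k) (\<lambda>v. ennreal (iso_gauss_density (mu k) \<sigma>x v))" if "k \<in> K" for k
      using iso_gauss_pair_marginals(1)[OF XH[OF that] sx se] .
    note fam = pair_families_independent[OF ind K iso_gauss_pair_marginals(3)[OF XH sx se]]
    have iX: "indep_vars (\<lambda>_. borel) X K" and iH: "indep_vars (\<lambda>_. borel) H K"
      by (rule fam(1); assumption) (rule fam(2); assumption)
    have mu_le: "norm (mu k) \<le> \<mu>hat" if "k \<in> K" for k
    proof -
      have "(case k of (i, j) \<Rightarrow> norm (\<mu> i j)) \<le> \<mu>hat"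
        unfolding muhat_def using that Ksub by (intro cSUP_upper mu_bdd) auto
      thus ?thesis by (simp add: mu_def split_def)
    qed
    have muhat0: "0 \<le> \<mu>hat" using mu_le K(2) norm_ge_zero by (meson all_not_in_conv order_trans)
    define A where "A = mat 1 + (4 / (N * \<sigma>x\<^sup>2)) *\<^sub>R (\<Sum>k\<in>K. outer (mu k) (mu k))"
    define \<Lambda> where "\<Lambda> = lambda_min A"
    have Av: "A *v v = v + (4 / (N * \<sigma>x\<^sup>2)) *\<^sub>R (\<Sum>k\<in>K. (mu k \<bullet> v) *\<^sub>R mu k)" for v
      unfolding A_def by (simp add: matrix_vector_mult_add_rdistrib scaleR_matrix_vector_assoc[symmetric] outer_sum_mult)
    have vAv: "v \<bullet> (A *v v) = (norm v)\<^sup>2 + 4 / (N * \<sigma>x\<^sup>2) * (\<Sum>k\<in>K. (mu k \<bullet> v)\<^sup>2)" for v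
      by (simp add: Av inner_add_right inner_sum_right inner_commute flip: power2_norm_eq_inner)
        (simp add: power2_eq_square)
    have sym: "u \<bullet> (A *v v) = (A *v u) \<bullet> v" for u v
      by (simp add: Av inner_add_right inner_add_left inner_sum_right inner_sum_left inner_commute mult.commute)
    have ge: "(norm v)\<^sup>2 \<le> v \<bullet> (A *v v)" for v
      using N0 by (simp add: vAv sum_nonneg)
    note \<Lambda> = lambda_min_psd[OF sym ge, folded \<Lambda>_def]
    have \<Lambda>_le: "\<Lambda> \<le> 1 + 4 * (\<mu>hat / \<sigma>x)\<^sup>2 / real CARD('n)"
    proof -
      \<comment> \<open>A trace argument: n \<Lambda> is at most the trace of \<open>A\<close>, and
        the trace of the mean part is the sum of the squared norms of the means. This produces the
        gain 1 / n that the final arithmetic relies on.\<close>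
      have "real CARD('n) * \<Lambda> = (\<Sum>b\<in>(Basis :: (real^'n) set). \<Lambda> * (norm b)\<^sup>2)" by simp
      also have "\<dots> \<le> (\<Sum>b\<in>Basis. b \<bullet> (A *v b))" by (intro sum_mono \<Lambda>(2))
      also have "\<dots> = real CARD('n) + 4 / (N * \<sigma>x\<^sup>2) * (\<Sum>k\<in>K. \<Sum>b\<in>Basis. (mu k \<bullet> b)\<^sup>2)"
        by (subst sum.swap) (simp add: vAv sum.distrib sum_distrib_left sum_divide_distrib)
      also have "\<dots> \<le> real CARD('n) + 4 / (N * \<sigma>x\<^sup>2) * (\<Sum>k\<in>K. \<mu>hat\<^sup>2)"
      proof (intro add_left_mono mult_left_mono sum_mono)
        fix k assume "k \<in> K"
        have "(\<Sum>b\<in>Basis. (mu k \<bullet> b)\<^sup>2) = (norm (mu k))\<^sup>2"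
          unfolding power2_norm_eq_inner euclidean_inner[of "mu k" "mu k"] by (simp add: power2_eq_square)
        thus "(\<Sum>b\<in>Basis. (mu k \<bullet> b)\<^sup>2) \<le> \<mu>hat\<^sup>2" using mu_le[OF \<open>k \<in> K\<close>] by (simp add: power_mono)
      qed (use N0 in simp)
      also have "4 / (N * \<sigma>x\<^sup>2) * (\<Sum>k\<in>K. \<mu>hat\<^sup>2) = 4 * (\<mu>hat / \<sigma>x)\<^sup>2"
        using N0 sx by (simp add: N_def power_divide)
      finally have "real CARD('n) * \<Lambda> \<le> real CARD('n) + 4 * (\<mu>hat / \<sigma>x)\<^sup>2" .
      hence "\<Lambda> \<le> (real CARD('n) + 4 * (\<mu>hat / \<sigma>x)\<^sup>2) / real CARD('n)"
        by (subst pos_le_divide_eq) (simp_all add: mult.commute)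
      thus ?thesis by (simp add: add_divide_distrib)
    qed
    define T where "T = \<sigma>\<eta> * sqrt (10 * real CARD('n) + 2 * real CARD('l) + 4 * L)"
    define \<kappa> where "\<kappa> = N * \<sigma>x\<^sup>2 * (1 + \<Lambda>) / 16"
    \<comment> \<open>The design bound with the mean term discarded. Its only task is to certify
      that |X^T v| is a norm; the quotient uses the stronger \<kappa>.\<close>
    define \<alpha> where "\<alpha> = sqrt (N * \<sigma>x\<^sup>2 / 8)"
    have \<alpha>: "0 < \<alpha>" "\<alpha>\<^sup>2 = N * \<sigma>x\<^sup>2 / 8" using N0 sx by (auto simp: \<alpha>_def)
    have \<kappa>: "0 < \<kappa>" using N0 sx \<Lambda>(1) by (simp add: \<kappa>_def)
    have T0: "0 \<le> T" "T\<^sup>2 = \<sigma>\<eta>\<^sup>2 * (10 * real CARD('n) + 2 * real CARD('l) + 4 * L)"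
      using se L2 by (auto simp: T_def power_mult_distrib)
    have "T / sqrt \<kappa> \<le> 8 * \<sigma>\<eta> * (4 * \<sigma>x * sqrt ((real CARD('n) + real CARD('l)) * ln (9 / \<delta>))
              + \<mu>hat * (sqrt (2 * (real CARD('l) + real CARD('n))) + 2 * sqrt L)) / (sqrt N * \<sigma>x\<^sup>2 * \<Lambda>)"
      unfolding T_def \<kappa>_def
    proof (rule error_bound_arith[OF _ _ L2 _ muhat0 sx se N0 \<Lambda>(1) \<Lambda>_le])
      show "L \<le> ln (9 / \<delta>)" unfolding L_def using delta_pos by (intro ln_mono) (auto simp: field_simps)
    qed (auto simp: Suc_leI)
    also have "\<dots> = ?bound"
      by (simp only: L_def \<Lambda>_def A_def N_eq dsum mu_def)
    finally have bound: "T / sqrt \<kappa> \<le> ?bound" .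
    obtain G1 where G1: "G1 \<in> events" "prob (space M - G1) \<le> 2 * exp (- L)"
      and G1v: "\<And>\<omega> v. \<omega> \<in> G1 \<Longrightarrow> N * \<sigma>x\<^sup>2 / 8 * ((norm v)\<^sup>2 + 2 / (N * \<sigma>x\<^sup>2) * (\<Sum>k\<in>K. (mu k \<bullet> v)\<^sup>2)) \<le> (\<Sum>k\<in>K. (X k \<omega> \<bullet> v)\<^sup>2)"
      using iso_gauss_design_lower_bound[OF Xdist iX K(1) sx, of L] L2 N_ge unfolding N_def by auto
    obtain G2 where G2: "G2 \<in> events" "prob (space M - G2) \<le> exp (- L)"
      and G2v: "\<And>\<omega> v. \<omega> \<in> G2 \<Longrightarrow> (\<And>v. \<alpha>\<^sup>2 * (norm v)\<^sup>2 \<le> (\<Sum>k\<in>K. (X k \<omega> \<bullet> v)\<^sup>2)) \<Longrightarrow>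
        (norm (\<Sum>k\<in>K. (X k \<omega> \<bullet> v) *\<^sub>R H k \<omega>))\<^sup>2 \<le> T\<^sup>2 * (\<Sum>k\<in>K. (X k \<omega> \<bullet> v)\<^sup>2)"
      using iso_gauss_noise_uniform_bound[OF XH ind K sx se \<alpha>(1), of L] unfolding T0(2) by blast
    have good: "?err \<omega> \<le> ?bound" if \<omega>: "\<omega> \<in> G1 \<inter> G2" for \<omega>
    proof -
      have "\<alpha>\<^sup>2 * (norm v)\<^sup>2 \<le> (\<Sum>k\<in>K. (X k \<omega> \<bullet> v)\<^sup>2)" for v
      proof -
        have "\<alpha>\<^sup>2 * (norm v)\<^sup>2 \<le> N * \<sigma>x\<^sup>2 / 8 * ((norm v)\<^sup>2 + 2 / (N * \<sigma>x\<^sup>2) * (\<Sum>k\<in>K. (mu k \<bullet> v)\<^sup>2))"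
          unfolding \<alpha>(2) using N0 by (intro mult_left_mono) (auto intro!: sum_nonneg divide_nonneg_nonneg)
        thus ?thesis using G1v[of \<omega> v] \<omega> by simp
      qed
      hence up: "(norm (\<Sum>k\<in>K. (X k \<omega> \<bullet> v) *\<^sub>R H k \<omega>))\<^sup>2 \<le> T\<^sup>2 * (\<Sum>k\<in>K. (X k \<omega> \<bullet> v)\<^sup>2)" for v
        using G2v[of \<omega> v] \<omega> by auto
      have low: "\<kappa> * (norm v)\<^sup>2 \<le> (\<Sum>k\<in>K. (X k \<omega> \<bullet> v)\<^sup>2)" for v
      proof -
        \<comment> \<open>The weight 2 in the adapted norm is half the weight 4 in \<open>A\<close>,
          so its square averages the forms of the identity and of \<open>A\<close>. Hence the factor
          (1 + \<Lambda>) / 2.\<close>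
        have "(norm v)\<^sup>2 + 2 / (N * \<sigma>x\<^sup>2) * (\<Sum>k\<in>K. (mu k \<bullet> v)\<^sup>2) = ((norm v)\<^sup>2 + v \<bullet> (A *v v)) / 2"
          by (simp add: vAv add_divide_distrib)
        hence "(1 + \<Lambda>) / 2 * (norm v)\<^sup>2 \<le> (norm v)\<^sup>2 + 2 / (N * \<sigma>x\<^sup>2) * (\<Sum>k\<in>K. (mu k \<bullet> v)\<^sup>2)"
          using \<Lambda>(2)[of v] by (simp add: algebra_simps)
        hence "N * \<sigma>x\<^sup>2 / 8 * ((1 + \<Lambda>) / 2 * (norm v)\<^sup>2) \<le> N * \<sigma>x\<^sup>2 / 8 * ((norm v)\<^sup>2 + 2 / (N * \<sigma>x\<^sup>2) * (\<Sum>k\<in>K. (mu k \<bullet> v)\<^sup>2))"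
          using N0 by (intro mult_left_mono) auto
        also have "\<dots> \<le> (\<Sum>k\<in>K. (X k \<omega> \<bullet> v)\<^sup>2)" using G1v \<omega> by auto
        finally show ?thesis by (simp add: \<kappa>_def)
      qed
      have "?err \<omega> \<le> T / sqrt \<kappa>"
        using least_squares_error[OF low \<kappa> T0(1) up, of \<Theta>] by (simp only: dsum X_def H_def)
      thus ?thesis using bound by simp
    qed
    have [measurable]: "X k \<in> borel_measurable M" "H k \<in> borel_measurable M" if "k \<in> K" for k
      using iX iH that by (auto simp: indep_vars_def)
    note [measurable] = borel_measurable_matrix_inv
    have "{\<omega> \<in> space M. ?err \<omega> \<le> ?bound} = {\<omega> \<in> space M. ((\<Sum>k\<in>K. outer (\<Theta> *v X k \<omega> + H k \<omega>) (X k \<omega>))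
                 ** matrix_inv (\<Sum>k\<in>K. outer (X k \<omega>) (X k \<omega>)) - \<Theta>) \<in> {A. spec_norm A \<le> ?bound}}"
      by (simp only: dsum X_def H_def mem_Collect_eq)
    also have "\<dots> \<in> events"
      using borel_closed[OF closed_spec_norm_le] by measurable
    finally have ev: "{\<omega> \<in> space M. ?err \<omega> \<le> ?bound} \<in> events" .
    have "prob (space M - G1 \<inter> G2) \<le> prob (space M - G1) + prob (space M - G2)"
      using G1(1) G2(1) unfolding Diff_Int by (intro measure_Un_le) auto
    \<comment> \<open>The total is three times exp (- L) = \<delta> / 2, namely two design tails and
      one noise tail.\<close>
    also have "\<dots> \<le> 4 * \<delta>" using G1(2) G2(2) eL delta_pos by simp
    finally have "1 - 4 * \<delta> \<le> prob (G1 \<inter> G2)"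
      using prob_compl[of "G1 \<inter> G2"] G1(1) G2(1) by simp
    also have "\<dots> \<le> prob {\<omega> \<in> space M. ?err \<omega> \<le> ?bound}"
      using good sets.sets_into_space[OF G1(1)] by (intro finite_measure_mono ev) auto
    finally show ?thesis .
  qed
qed

end
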